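(* Let $P$ be a $d$-dimensional prism-like polyhedron. Then for any choice of $b(P)$ (i.e., for any $d$-dimensional prism $P'=\Delta_1\times\cdots\times\Delta_m$ and any order-preserving injective map $f$ from the face lattice of $P$ to the face lattice of $P'$), the set $b(P)$ is an ample subset of $U=U_1\times\cdots\times U_m$, where $U_i$ is the vertex set of $\Delta_i$, and $b(P)$ admits a corner peeling.
   Context: A polyhedron is an intersection of finitely many closed halfspaces in $\mathbb R^d$. A prism is a Cartesian product $P'=\Delta_1\times\cdots\times\Delta_m$ of simplices; if $U_i$ is the vertex set of $\Delta_i$, then $U=U_1\times\cdots\times U_m$ is the vertex set of $P'$. A $d$-dimensional polyhedron $P$ is prism-like if there is an order-preserving injective map $f$ from the face lattice of $P$ (including the empty face and $P$) to the face lattice of a $d$-dimensional prism $P'$. Such $f$ maps vertices to vertices; $b(P)\subseteq U$ denotes the set of vertices $v'$ of $P'$ with $v'=f(v)$ for some vertex $v$ of $P$ (it depends on the choice of $P'$ and $f$). For a Cartesian product $U=U_1\times\cdots\times U_m$ of nonempty finite sets, a box is a set $B_1\times\cdots\times B_m$ with $\varnothing\ne B_i\subseteq U_i$. A generalized partition is a tuple $\Lambda=(\alpha_1,\dots,\alpha_m)$ with $\alpha_i$ a partition of $U_i$ into nonempty blocks; it defines a partition of $U$ into the boxes $P^1\times\cdots\times P^m$, $P^i\in\alpha_i$, and the minor-subproduct $M(\Lambda)=M_1\times\cdots\times M_m$, where $M_i$ is the set of blocks of $\alpha_i$. $M(\Lambda)$ is shattered by $S\subseteq U$ if $S$ meets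 every box of the box-partition. A copy of $M(\Lambda)$ is a set $W_1\times\cdots\times W_m$ where $W_i$ consists of exactly one element from each block of $\alpha_i$. $M(\Lambda)$ is strongly shattered by $S$ if $S$ contains a copy of it. $S$ is ample if every minor-subproduct of $U$ shattered by $S$ is strongly shattered by $S$. A corner of a set $S\subseteq U$ is an element $s\in S$ belonging to a unique inclusion-maximal box contained in $S$. A corner peeling of $S$ is a total ordering $s_1,\dots,s_n$ of $S$ such that for each $i=n,\dots,1$, $s_i$ is a corner of $\{s_1,\dots,s_i\}$. *)

theory Defs
  imports "HOL-Analysis.Analysis" "HOL-Library.Disjoint_Sets"
begin

text \<open>
  Products with \<open>m\<close> factors are indexed by a finite type \<open>'m\<close> and live in \<open>'a ^ 'm\<close>.
\<close>

definition coord_product :: "('m::finite \<Rightarrow> 'a set) \<Rightarrow> ('a ^ 'm) set" where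
  "coord_product A = {x. \<forall>i. x $ i \<in> A i}"


subsection \<open>Ample sets in Cartesian products of finite sets\<close>

definition generalized_partition :: "('m \<Rightarrow> 'a set) \<Rightarrow> ('m \<Rightarrow> 'a set set) \<Rightarrow> bool" where
  "generalized_partition U \<alpha> \<longleftrightarrow> (\<forall>i. partition_on (U i) (\<alpha> i))"

text \<open>
  The minor-subproduct \<open>M(\<alpha>)\<close>: its elements are the tuples of blocks, and \<open>coord_product (($) p)\<close>
  is the box of the partition of \<open>U\<close> that corresponds to the tuple \<open>p\<close>.
\<close>

definition minor_subproduct :: "('m::finite \<Rightarrow> 'a set set) \<Rightarrow> ('a set ^ 'm) set" where
  "minor_subproduct \<alpha> = coord_product \<alpha>"

definition box_partition :: "('m::finite \<Rightarrow> 'a set set) \<Rightarrow> ('a ^ 'm) set set" where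
  "box_partition \<alpha> = (\<lambda>p. coord_product (($) p)) ` minor_subproduct \<alpha>"

definition shattered :: "('m::finite \<Rightarrow> 'a set set) \<Rightarrow> ('a ^ 'm) set \<Rightarrow> bool" where
  "shattered \<alpha> S \<longleftrightarrow> (\<forall>B \<in> box_partition \<alpha>. S \<inter> B \<noteq> {})"

definition is_copy :: "('m::finite \<Rightarrow> 'a set set) \<Rightarrow> ('a ^ 'm) set \<Rightarrow> bool" where
  "is_copy \<alpha> C \<longleftrightarrow>
     (\<exists>W. (\<forall>i. W i \<subseteq> \<Union>(\<alpha> i) \<and> (\<forall>A \<in> \<alpha> i. \<exists>!w. w \<in> W i \<inter> A)) \<and> C = coord_product W)"

definition strongly_shattered :: "('m::finite \<Rightarrow> 'a set set) \<Rightarrow> ('a ^ 'm) set \<Rightarrow> bool" where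
  "strongly_shattered \<alpha> S \<longleftrightarrow> (\<exists>C. is_copy \<alpha> C \<and> C \<subseteq> S)"

definition ample :: "('m::finite \<Rightarrow> 'a set) \<Rightarrow> ('a ^ 'm) set \<Rightarrow> bool" where
  "ample U S \<longleftrightarrow> S \<subseteq> coord_product U \<and>
     (\<forall>\<alpha>. generalized_partition U \<alpha> \<longrightarrow> shattered \<alpha> S \<longrightarrow> strongly_shattered \<alpha> S)"


subsection \<open>Corners and corner peelings\<close>

definition is_box :: "('m::finite \<Rightarrow> 'a set) \<Rightarrow> ('a ^ 'm) set \<Rightarrow> bool" where
  "is_box U B \<longleftrightarrow> (\<exists>A. (\<forall>i. A i \<noteq> {} \<and> A i \<subseteq> U i) \<and> B = coord_product A)"

definition maximal_box_in :: "('m::finite \<Rightarrow> 'a set) \<Rightarrow> ('a ^ 'm) set \<Rightarrow> ('a ^ 'm) set \<Rightarrow> bool" where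
  "maximal_box_in U S B \<longleftrightarrow> is_box U B \<and> B \<subseteq> S \<and>
     (\<forall>B'. is_box U B' \<and> B' \<subseteq> S \<and> B \<subseteq> B' \<longrightarrow> B' = B)"

definition corner :: "('m::finite \<Rightarrow> 'a set) \<Rightarrow> ('a ^ 'm) set \<Rightarrow> 'a ^ 'm \<Rightarrow> bool" where
  "corner U S s \<longleftrightarrow> s \<in> S \<and> (\<exists>!B. maximal_box_in U S B \<and> s \<in> B)"

definition corner_peeling :: "('m::finite \<Rightarrow> 'a set) \<Rightarrow> ('a ^ 'm) set \<Rightarrow> ('a ^ 'm) list \<Rightarrow> bool" where
  "corner_peeling U S xs \<longleftrightarrow> distinct xs \<and> set xs = S \<and>
     (\<forall>i < length xs. corner U (set (take (Suc i) xs)) (xs ! i))"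


subsection \<open>Prisms and maps of face lattices\<close>

definition vertices :: "'a::real_vector set \<Rightarrow> 'a set" where
  "vertices S = {v. v extreme_point_of S}"

text \<open>
  The library's simplices include the empty set, of dimension \<open>-1\<close>; the coercion from
  \<open>nat\<close> excludes it.
\<close>

definition prism_factors :: "('m::finite \<Rightarrow> 'a::euclidean_space set) \<Rightarrow> bool" where
  "prism_factors \<Delta> \<longleftrightarrow> (\<forall>i. \<exists>n::nat. int n simplex \<Delta> i)"

text \<open>
  \<open>S face_of T\<close> also holds for \<open>S = {}\<close> and, for convex \<open>T\<close>, for \<open>S = T\<close>; for a polyhedron
  \<open>T\<close>, the faces in this sense are the empty set and the intersections of \<open>T\<close> with supporting
  hyperplanes, together with \<open>T\<close> itself.
\<close>

definition face_lattice :: "'a::real_vector set \<Rightarrow> 'a set set" where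
  "face_lattice T = {F. F face_of T}"

definition face_lattice_injection ::
    "'a::real_vector set \<Rightarrow> 'b::real_vector set \<Rightarrow> ('a set \<Rightarrow> 'b set) \<Rightarrow> bool" where
  "face_lattice_injection P P' f \<longleftrightarrow>
     f \<in> face_lattice P \<rightarrow> face_lattice P' \<and> inj_on f (face_lattice P) \<and> mono_on (face_lattice P) f"

text \<open>The set \<open>b(P)\<close>; the vertex \<open>v\<close> is the face \<open>{v}\<close> of the face lattice.\<close>

definition b_set ::
    "'a::real_vector set \<Rightarrow> 'b::real_vector set \<Rightarrow> ('a set \<Rightarrow> 'b set) \<Rightarrow> 'b set" where
  "b_set P P' f = {v' \<in> vertices P'. \<exists>v \<in> vertices P. f {v} = {v'}}"

end

theory Submission
  imports Defs
begin

text \<open>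
  Counting ranks along chains of faces shows that the map of face lattices preserves dimensions,
  so at a vertex \<open>v\<close> it embeds the facets of \<open>P\<close> into the \<open>d\<close> facets of the prism at the image of
  \<open>v\<close>. Since \<open>P\<close> has at least \<open>d\<close> facets at \<open>v\<close>, it is simple, and every face of the prism at the
  image of \<open>v\<close> is the image of a unique face at \<open>v\<close>. Images of bounded faces are boxes contained in
  \<open>b(P)\<close>.

  For the corner peeling, order the vertices by a generic linear functional that is positive on the
  recession cone. The descending edges at \<open>v\<close> span a face on which \<open>v\<close> is maximal. This face is
  bounded, and its box is the unique maximal box at \<open>v\<close> among the vertices up to \<open>v\<close>.

  For ampleness, suppose \<open>b(P)\<close> meets every box of a partition. Choosing a vertex of \<open>P\<close> for each
  box and interpolating yields a map from the prism to \<open>P\<close>; pushing backwards along recession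
  directions moves its values into the union of the bounded faces. By Brouwer's theorem, some value
  lies in a bounded face whose box meets every block of the partitions in every coordinate, and such
  a box contains a copy of the minor-subproduct.
\<close>

section \<open>Coordinate products\<close>

text \<open>The hypothesis on \<open>f\<close> is weak: it preserves order, but it is not assumed to
  respect intersections, to reflect inclusion or to reach every face. All structure therefore comes
  from counting. A maximal chain of faces of \<open>P\<close> through a given face already uses
  every rank that the prism offers, so no rank is skipped. Intersections of facets and the
  reflection of inclusion are then recovered from equalities of ranks. The other obstacle is
  unboundedness. The box of a face may contain elements that are images of no vertex of
  \<open>P\<close>, since an edge of \<open>P\<close> may be a ray; bounded faces do not have this
  defect. This is why the functional is positive on recession directions: a face on which it is
  bounded above is then a bounded face. It is also why ampleness needs the push: interpolation
  yields points in arbitrary faces of \<open>P\<close>, and moving backwards along recession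
  directions maps every face to itself, so the boundary conditions of the fixed-point argument
  survive.\<close>

definition vec_update :: "'a ^ 'm::finite \<Rightarrow> 'm \<Rightarrow> 'a \<Rightarrow> 'a ^ 'm" where
  "vec_update x i a = (\<chi> j. if j = i then a else x $ j)"

lemma vec_update_nth: "vec_update x i a $ j = (if j = i then a else x $ j)"
  by (simp add: vec_update_def)

lemma mem_coord_product: "x \<in> coord_product A \<longleftrightarrow> (\<forall>i. x $ i \<in> A i)"
  by (simp add: coord_product_def)

lemma coord_product_nonempty:
  assumes "\<And>i. A i \<noteq> {}"
  shows "coord_product A \<noteq> {}"
proof -
  have "(\<chi> i. SOME a. a \<in> A i) \<in> coord_product A"
    using assms by (auto simp: mem_coord_product some_in_eq)
  then show ?thesis by blast
qed

lemma nth_image_coord_product: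
  assumes "\<And>j. A j \<noteq> {}"
  shows "(\<lambda>x. x $ i) ` coord_product A = A i"
proof
  show "(\<lambda>x. x $ i) ` coord_product A \<subseteq> A i" by (auto simp: mem_coord_product)
next
  obtain x where x: "x \<in> coord_product A" using coord_product_nonempty[of A, OF assms] by blast
  show "A i \<subseteq> (\<lambda>x. x $ i) ` coord_product A"
  proof
    fix a assume "a \<in> A i"
    then have "vec_update x i a \<in> coord_product A" using x by (auto simp: mem_coord_product vec_update_nth)
    then show "a \<in> (\<lambda>x. x $ i) ` coord_product A" by (force simp: vec_update_nth)
  qed
qed

lemma convex_coord_product:
  fixes D :: "'m::finite \<Rightarrow> 'a::real_vector set"
  assumes "\<And>i. convex (D i)"
  shows "convex (coord_product D)"
  using assms by (auto simp: convex_alt mem_coord_product)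

lemma closed_coord_product:
  fixes D :: "'m::finite \<Rightarrow> 'a::topological_space set"
  assumes "\<And>i. closed (D i)"
  shows "closed (coord_product D)"
proof -
  have "coord_product D = (\<Inter>i. (\<lambda>x. x $ i) -` D i)" by (auto simp: coord_product_def)
  then show ?thesis using assms by (auto intro!: closed_INT closed_vimage_vec_nth)
qed

lemma compact_coord_product:
  fixes D :: "'m::finite \<Rightarrow> 'a::euclidean_space set"
  assumes "\<And>i. compact (D i)"
  shows "compact (coord_product D)"
proof -
  have "\<forall>i. \<exists>b. \<forall>x\<in>D i. norm x \<le> b"
    using assms compact_imp_bounded bounded_iff by blast
  then obtain b where b: "\<And>i x. x \<in> D i \<Longrightarrow> norm x \<le> b i" by metis
  have "norm x \<le> (\<Sum>i\<in>UNIV. b i)" if "x \<in> coord_product D" for x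
  proof -
    have "norm x \<le> (\<Sum>i\<in>UNIV. norm (x $ i))"
      unfolding norm_vec_def by (rule L2_set_le_sum) auto
    also have "\<dots> \<le> (\<Sum>i\<in>UNIV. b i)"
      using that b by (intro sum_mono) (auto simp: mem_coord_product)
    finally show ?thesis .
  qed
  then have "bounded (coord_product D)" unfolding bounded_iff by blast
  moreover have "closed (coord_product D)"
    using assms by (intro closed_coord_product compact_imp_closed)
  ultimately show ?thesis by (simp add: compact_eq_bounded_closed)
qed

section \<open>Faces of a product are the products of faces\<close>

lemma face_of_coord_product:
  fixes D :: "'m::finite \<Rightarrow> 'a::real_vector set"
  assumes "\<And>i. G i face_of D i"
  shows "coord_product G face_of coord_product D"
  unfolding face_of_def
proof (intro conjI ballI impI)
  have sub: "\<And>i. G i \<subseteq> D i" using assms face_of_imp_subset by blast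
  show "coord_product G \<subseteq> coord_product D" using sub by (fastforce simp: mem_coord_product)
  show "convex (coord_product G)" using assms face_of_imp_convex by (intro convex_coord_product) blast
  fix x y z assume x: "x \<in> coord_product D" and y: "y \<in> coord_product D"
    and z: "z \<in> coord_product G" and seg: "z \<in> open_segment x y"
  obtain u where u: "0 < u" "u < 1" "z = (1 - u) *\<^sub>R x + u *\<^sub>R y"
    using seg by (auto simp: in_segment)
  have "x $ i \<in> G i \<and> y $ i \<in> G i" for i
  proof (cases "x $ i = y $ i")
    case True
    have "z $ i = (1 - u) *\<^sub>R x $ i + u *\<^sub>R y $ i" using u by simp
    then have "z $ i = x $ i" using True by (simp add: algebra_simps)
    then show ?thesis using z True by (metis mem_coord_product)
  next
    case False
    have "z $ i = (1 - u) *\<^sub>R x $ i + u *\<^sub>R y $ i" using u by simp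
    then have "z $ i \<in> open_segment (x $ i) (y $ i)" using u False by (auto simp: in_segment)
    moreover have "x $ i \<in> D i" "y $ i \<in> D i" "z $ i \<in> G i"
      using x y z by (auto simp: mem_coord_product)
    ultimately show ?thesis using face_ofD[OF assms[of i]] by blast
  qed
  then show "x \<in> coord_product G" "y \<in> coord_product G" by (auto simp: mem_coord_product)
qed

text \<open>A face of a product is closed under exchanging a coordinate between two of its points,
  because the two exchanged points have the same midpoint.\<close>

lemma face_of_coord_product_exchange:
  fixes D :: "'m::finite \<Rightarrow> 'a::real_vector set"
  assumes G: "G face_of coord_product D" and x: "x \<in> G" and y: "y \<in> G"
  shows "vec_update x i (y $ i) \<in> G"
proof -
  let ?p = "vec_update x i (y $ i)" and ?q = "vec_update y i (x $ i)"
  have D: "x \<in> coord_product D" "y \<in> coord_product D"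
    using assms face_of_imp_subset by blast+
  have pq: "?p \<in> coord_product D" "?q \<in> coord_product D"
    using D by (auto simp: mem_coord_product vec_update_nth)
  have "convex G" using G face_of_imp_convex by blast
  then have m: "midpoint x y \<in> G"
    using x y by (meson closed_segment_subset midpoint_in_closed_segment subsetD)
  have eq: "midpoint ?p ?q = midpoint x y"
    by (auto simp: midpoint_def vec_eq_iff vec_update_nth)
  show ?thesis
  proof (cases "?p = ?q")
    case True
    then show ?thesis using m eq by simp
  next
    case False
    then have "midpoint x y \<in> open_segment ?p ?q" using eq by (metis midpoint_in_open_segment)
    then show ?thesis using face_ofD[OF G] pq m by blast
  qed
qed

text \<open>Each coordinate of \<open>z\<close> is attained in \<open>G\<close>, but by different
  points; exchanges collect them, one index at a time, into a single point of
  \<open>G\<close>.\<close>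

lemma face_of_coord_product_eq:
  fixes D :: "'m::finite \<Rightarrow> 'a::real_vector set"
  assumes G: "G face_of coord_product D"
  shows "G = coord_product (\<lambda>i. (\<lambda>x. x $ i) ` G)"
proof
  show "G \<subseteq> coord_product (\<lambda>i. (\<lambda>x. x $ i) ` G)" by (auto simp: mem_coord_product)
next
  show "coord_product (\<lambda>i. (\<lambda>x. x $ i) ` G) \<subseteq> G"
  proof
    fix z assume z: "z \<in> coord_product (\<lambda>i. (\<lambda>x. x $ i) ` G)"
    have "\<exists>x\<in>G. \<forall>i\<in>I. x $ i = z $ i" if "finite I" for I
      using that
    proof induction
      case empty
      obtain x where "x \<in> G" using z by (auto simp: mem_coord_product)
      then show ?case by blast
    next
      case (insert i I)
      then obtain x where x: "x \<in> G" "\<forall>i\<in>I. x $ i = z $ i" by blast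
      obtain y where y: "y \<in> G" "y $ i = z $ i"
        using z unfolding mem_coord_product by (metis imageE)
      have "vec_update x i (y $ i) \<in> G"
        by (rule face_of_coord_product_exchange[OF G x(1) y(1)])
      moreover have "\<forall>j\<in>insert i I. vec_update x i (y $ i) $ j = z $ j"
        using x y insert by (auto simp: vec_update_nth)
      ultimately show ?case by blast
    qed
    from this[of UNIV] obtain x where "x \<in> G" "\<forall>i. x $ i = z $ i" by auto
    then show "z \<in> G" by (metis vec_eq_iff)
  qed
qed

lemma face_of_coord_product_nth_image:
  fixes D :: "'m::finite \<Rightarrow> 'a::real_vector set"
  assumes G: "G face_of coord_product D"
  shows "(\<lambda>x. x $ i) ` G face_of D i"
  unfolding face_of_def
proof (intro conjI ballI impI)
  have sub: "G \<subseteq> coord_product D" using G face_of_imp_subset by blast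
  show "(\<lambda>x. x $ i) ` G \<subseteq> D i" using sub by (auto simp: mem_coord_product)
  have lin: "linear (\<lambda>x::'a^'m. x $ i)" by (auto intro: linearI)
  show "convex ((\<lambda>x. x $ i) ` G)"
    using convex_linear_image[OF lin] face_of_imp_convex[OF G] by blast
  fix a b c assume a: "a \<in> D i" and b: "b \<in> D i" and c: "c \<in> (\<lambda>x. x $ i) ` G"
    and seg: "c \<in> open_segment a b"
  obtain x where x: "x \<in> G" "c = x $ i" using c by blast
  obtain u where u: "0 < u" "u < 1" "c = (1 - u) *\<^sub>R a + u *\<^sub>R b" "a \<noteq> b"
    using seg by (auto simp: in_segment)
  \<comment> \<open>A segment of the factor lifts to the product by freezing the other coordinates
    at those of a point of \<open>G\<close> over \<open>c\<close>.\<close>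
  let ?a = "vec_update x i a" and ?b = "vec_update x i b"
  have ab: "?a \<in> coord_product D" "?b \<in> coord_product D"
    using sub x(1) a b by (auto simp: mem_coord_product vec_update_nth subset_iff)
  have "x = (1 - u) *\<^sub>R ?a + u *\<^sub>R ?b"
    using u x by (auto simp: vec_eq_iff vec_update_nth algebra_simps)
  moreover have "?a \<noteq> ?b" using u by (metis vec_update_nth)
  ultimately have "x \<in> open_segment ?a ?b" using u by (auto simp: in_segment)
  then have "?a \<in> G" "?b \<in> G" using face_ofD[OF G] ab x by blast+
  then show "a \<in> (\<lambda>x. x $ i) ` G" "b \<in> (\<lambda>x. x $ i) ` G"
    by (force simp: vec_update_nth)+
qed

section \<open>Faces of prisms\<close>

definition box_face :: "('m::finite \<Rightarrow> 'b::real_vector set) \<Rightarrow> ('b ^ 'm) set" where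
  "box_face A = coord_product (\<lambda>i. convex hull (A i))"

text \<open>For vertex sets of faces of simplices, the dimension of the product of these faces. It
  is kept combinatorial because it also counts neighbours (\<open>card_neighbours\<close>), with
  which the facets at a vertex are compared.\<close>

definition box_rank :: "('m::finite \<Rightarrow> 'b set) \<Rightarrow> nat" where
  "box_rank A = (\<Sum>i\<in>UNIV. card (A i) - 1)"

text \<open>The pairs \<open>(i, u)\<close> stand for the neighbours of \<open>s\<close> in the box with sides \<open>A i\<close>.\<close>

definition neighbours :: "'b ^ 'm::finite \<Rightarrow> ('m \<Rightarrow> 'b set) \<Rightarrow> ('m \<times> 'b) set" where
  "neighbours s A = Sigma UNIV (\<lambda>i. A i - {s $ i})"

lemma mem_neighbours: "(i, u) \<in> neighbours s A \<longleftrightarrow> u \<in> A i \<and> u \<noteq> s $ i"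
  by (auto simp: neighbours_def)

lemma finite_neighbours:
  assumes "\<And>i. finite (A i)"
  shows "finite (neighbours s A)"
  unfolding neighbours_def using assms by (intro finite_SigmaI) auto

lemma card_neighbours:
  assumes "\<And>i. finite (A i)" "s \<in> coord_product A"
  shows "card (neighbours s A) = box_rank A"
proof -
  have "card (neighbours s A) = (\<Sum>i\<in>UNIV. card (A i - {s $ i}))"
    unfolding neighbours_def using assms by (intro card_SigmaI) auto
  also have "\<dots> = box_rank A"
    unfolding box_rank_def using assms
    by (intro sum.cong refl card_Diff_singleton) (auto simp: mem_coord_product)
  finally show ?thesis .
qed

lemma simplex_vertices:
  fixes T :: "'b::euclidean_space set"
  assumes "int n simplex T"
  shows "finite (vertices T)" "vertices T \<noteq> {}" "\<not> affine_dependent (vertices T)"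
    "convex hull (vertices T) = T"
proof -
  obtain C where C: "\<not> affine_dependent C" "int (card C) = int n + 1" "T = convex hull C"
    using assms by (auto simp: simplex_def)
  have eq: "vertices T = C"
    using C extreme_point_of_convex_hull_affine_independent[OF C(1)] by (auto simp: vertices_def)
  show "finite (vertices T)" "vertices T \<noteq> {}" "\<not> affine_dependent (vertices T)"
    "convex hull (vertices T) = T"
    using C eq aff_independent_finite by auto
qed

text \<open>An element of \<open>V\<close> outside \<open>A\<close> is not even in the affine hull
  of \<open>A\<close>. This lets \<open>face_box\<close> recover the sides of a box from their
  hulls.\<close>

lemma affine_independent_convex_hull_Int:
  fixes V :: "'b::euclidean_space set"
  assumes "\<not> affine_dependent V" "A \<subseteq> V"
  shows "V \<inter> convex hull A = A"
proof
  show "V \<inter> convex hull A \<subseteq> A"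
  proof
    fix u assume u: "u \<in> V \<inter> convex hull A"
    have "u \<notin> affine hull A" if "u \<notin> A"
    proof -
      have "A \<subseteq> V - {u}" using assms that by auto
      then have "affine hull A \<subseteq> affine hull (V - {u})" by (rule hull_mono)
      then show ?thesis using assms u by (auto simp: affine_dependent_def)
    qed
    then show "u \<in> A" using u convex_hull_subset_affine_hull by blast
  qed
next
  show "A \<subseteq> V \<inter> convex hull A" using assms(2) hull_subset[of A convex] by blast
qed

locale prism =
  fixes \<Delta> :: "'m::finite \<Rightarrow> 'b::euclidean_space set"
  assumes prism_factors: "prism_factors \<Delta>"
begin

definition U :: "'m \<Rightarrow> 'b set" where
  "U i = vertices (\<Delta> i)"

definition box :: "('m \<Rightarrow> 'b set) \<Rightarrow> bool" where
  "box A \<longleftrightarrow> (\<forall>i. A i \<noteq> {} \<and> A i \<subseteq> U i)"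

text \<open>Inverse to \<open>box_face\<close> between boxes and nonempty faces, by
  \<open>face_box_box_face\<close> and \<open>face_box\<close>.\<close>

definition face_box :: "('b ^ 'm) set \<Rightarrow> 'm \<Rightarrow> 'b set" where
  "face_box G i = U i \<inter> (\<lambda>x. x $ i) ` G"

lemma U: "finite (U i)" "U i \<noteq> {}" "\<not> affine_dependent (U i)" "convex hull (U i) = \<Delta> i"
  using prism_factors simplex_vertices unfolding prism_factors_def U_def by blast+

lemma box_finite: "box A \<Longrightarrow> finite (A i)"
  using U(1) finite_subset unfolding box_def by blast

lemma box_U: "box U"
  by (simp add: box_def U)

lemma box_face_U: "box_face U = coord_product \<Delta>"
  by (simp add: box_face_def U)

lemma box_face_nonempty: "box A \<Longrightarrow> box_face A \<noteq> {}"
  unfolding box_face_def box_def by (intro coord_product_nonempty) auto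

lemma box_face_face_of:
  assumes "box A"
  shows "box_face A face_of coord_product \<Delta>"
  unfolding box_face_def
proof (rule face_of_coord_product)
  fix i show "convex hull A i face_of \<Delta> i"
    using face_of_convex_hull_affine_independent[OF U(3), of "convex hull A i" i] assms
    unfolding U(4) box_def by blast
qed

lemma face_box_box_face:
  assumes "box A"
  shows "face_box (box_face A) = A"
proof
  fix i
  have "(\<lambda>x. x $ i) ` box_face A = convex hull (A i)"
    unfolding box_face_def using assms by (intro nth_image_coord_product) (auto simp: box_def)
  then show "face_box (box_face A) i = A i"
    unfolding face_box_def using affine_independent_convex_hull_Int[OF U(3)] assms
    by (auto simp: box_def)
qed

text \<open>A face of the product is the product of its projections, and each projection is a face
  of a simplex, hence spanned by a set of vertices.\<close>

lemma face_box:
  assumes G: "G face_of coord_product \<Delta>" "G \<noteq> {}"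
  shows "box (face_box G)" "box_face (face_box G) = G"
proof -
  have *: "face_box G i \<subseteq> U i \<and> face_box G i \<noteq> {} \<and> convex hull (face_box G i) = (\<lambda>x. x $ i) ` G" for i
  proof -
    have "(\<lambda>x. x $ i) ` G face_of convex hull (U i)"
      unfolding U(4) by (rule face_of_coord_product_nth_image[OF G(1)])
    from iffD1[OF face_of_convex_hull_affine_independent[OF U(3)] this]
    obtain C where C: "C \<subseteq> U i" "(\<lambda>x. x $ i) ` G = convex hull C"
      by auto
    have eq: "face_box G i = C"
      unfolding face_box_def C(2) by (rule affine_independent_convex_hull_Int[OF U(3) C(1)])
    have "C \<noteq> {}" using C(2) G(2) by auto
    then show ?thesis unfolding eq using C by simp
  qed
  show "box (face_box G)" unfolding box_def by (simp add: *)
  have "box_face (face_box G) = coord_product (\<lambda>i. (\<lambda>x. x $ i) ` G)"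
    unfolding box_face_def by (simp add: *)
  also have "\<dots> = G" by (rule face_of_coord_product_eq[OF G(1), symmetric])
  finally show "box_face (face_box G) = G" .
qed

lemma box_face_subset_iff:
  assumes A: "box A" and B: "box B"
  shows "box_face A \<subseteq> box_face B \<longleftrightarrow> A \<le> B"
proof
  assume "box_face A \<subseteq> box_face B"
  then have "face_box (box_face A) \<le> face_box (box_face B)"
    by (auto simp: face_box_def le_fun_def)
  then show "A \<le> B" using face_box_box_face A B by simp
next
  assume "A \<le> B"
  then have "convex hull A i \<subseteq> convex hull B i" for i
    by (intro hull_mono) (auto simp: le_fun_def)
  then show "box_face A \<subseteq> box_face B"
    unfolding box_face_def coord_product_def by blast
qed

lemma box_rank_strict_mono:
  assumes "box A" "box B" "A \<le> B" "A \<noteq> B"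
  shows "box_rank A < box_rank B"
  unfolding box_rank_def
proof (rule sum_strict_mono_ex1)
  obtain i where i: "A i \<noteq> B i" using assms by blast
  have le: "card (A j) \<le> card (B j)" for j
    using assms box_finite by (intro card_mono) (auto simp: le_fun_def)
  then show "\<forall>j\<in>UNIV. card (A j) - 1 \<le> card (B j) - 1"
    by (simp add: diff_le_mono)
  have "card (A i) < card (B i)"
    using assms i box_finite by (intro psubset_card_mono) (auto simp: le_fun_def)
  moreover have "card (A i) > 0" using assms box_finite by (auto simp: card_gt_0_iff box_def)
  ultimately have "card (A i) - 1 < card (B i) - 1" by linarith
  then show "\<exists>j\<in>UNIV. card (A j) - 1 < card (B j) - 1" by blast
qed auto

lemma box_rank_eq_0:
  assumes "box A" "box_rank A = 0"
  obtains s where "A = (\<lambda>i. {s $ i})" "s \<in> coord_product U"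
proof -
  have "\<exists>a. A i = {a}" for i
  proof -
    have "card (A i) - 1 = 0" using assms(2) by (auto simp: box_rank_def)
    moreover have "card (A i) > 0" using assms box_finite by (auto simp: card_gt_0_iff box_def)
    ultimately have "card (A i) = 1" by linarith
    then show ?thesis by (simp add: card_1_singleton_iff)
  qed
  then obtain a where a: "\<And>i. A i = {a i}" by metis
  show ?thesis
    by (rule that[of "\<chi> i. a i"]) (use a assms(1) in \<open>auto simp: box_def mem_coord_product\<close>)
qed

lemma box_face_singleton: "box_face (\<lambda>i. {s $ i}) = {s}"
  by (auto simp: box_face_def coord_product_def vec_eq_iff)

lemma convex_prism: "convex (coord_product \<Delta>)"
  by (intro convex_coord_product) (metis U(4) convex_convex_hull)

lemma compact_prism: "compact (coord_product \<Delta>)"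
  using U by (intro compact_coord_product) (metis finite_imp_compact_convex_hull)

text \<open>Removing vertices one at a time yields a chain of faces, along which the affine
  dimension drops.\<close>

lemma box_rank_le_aff_dim:
  assumes "box A"
  shows "int (box_rank A) \<le> aff_dim (box_face A)"
  using assms
proof (induction "box_rank A" arbitrary: A)
  case 0
  then show ?case using aff_dim_negative_iff[of "box_face A"] box_face_nonempty[of A] by linarith
next
  case (Suc n)
  have "\<exists>i. card (A i) - 1 \<noteq> 0"
  proof (rule ccontr)
    assume "\<not> ?thesis"
    then have "box_rank A = 0" by (simp add: box_rank_def)
    then show False using Suc.hyps(2) by simp
  qed
  then obtain i where "card (A i) - 1 \<noteq> 0" by blast
  then have i: "card (A i) \<ge> 2" by linarith
  then have "A i \<noteq> {}" by auto
  then obtain u where u: "u \<in> A i" by blast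
  let ?B = "A(i := A i - {u})"
  have "A i \<noteq> {u}" using i by auto
  then have B: "box ?B" using Suc.prems u by (auto simp: box_def)
  have "?B \<le> A" "?B \<noteq> A" using u by (auto simp: le_fun_def fun_eq_iff)
  have "box_rank A = (card (A i) - 1) + (\<Sum>j\<in>UNIV - {i}. card (A j) - 1)"
    unfolding box_rank_def by (rule sum.remove) auto
  moreover have "box_rank ?B = (card (A i - {u}) - 1) + (\<Sum>j\<in>UNIV - {i}. card (?B j) - 1)"
    unfolding box_rank_def by (subst sum.remove[of _ i]) auto
  moreover have "(\<Sum>j\<in>UNIV - {i}. card (?B j) - 1) = (\<Sum>j\<in>UNIV - {i}. card (A j) - 1)"
    by (rule sum.cong) auto
  moreover have "card (A i - {u}) = card (A i) - 1" using u box_finite[OF Suc.prems] by simp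
  ultimately have "n = box_rank ?B" using i Suc.hyps(2) by linarith
  then have IH: "int (box_rank ?B) \<le> aff_dim (box_face ?B)" using Suc.hyps(1) B by blast
  have sub: "box_face ?B \<subseteq> box_face A" using box_face_subset_iff B Suc.prems \<open>?B \<le> A\<close> by blast
  have "box_face ?B face_of box_face A"
    using face_of_subset[OF box_face_face_of[OF B] sub] box_face_face_of[OF Suc.prems] face_of_imp_subset
    by blast
  moreover have "box_face ?B \<noteq> box_face A"
    using face_box_box_face[OF B] face_box_box_face[OF Suc.prems] \<open>?B \<noteq> A\<close> by metis
  moreover have "convex (box_face A)" using face_of_imp_convex box_face_face_of[OF Suc.prems] by blast
  ultimately have "aff_dim (box_face ?B) < aff_dim (box_face A)" by (intro face_of_aff_dim_lt)
  then show ?case using IH \<open>n = box_rank ?B\<close> Suc.hyps(2) by linarith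
qed

text \<open>The value -1 at the empty face matches \<open>aff_dim\<close>, so that chains may start
  at the empty face.\<close>

definition face_rank :: "('b ^ 'm) set \<Rightarrow> int" where
  "face_rank G = (if G = {} then - 1 else int (box_rank (face_box G)))"

lemma face_rank_strict_mono:
  assumes "G face_of coord_product \<Delta>" "H face_of coord_product \<Delta>" "G \<subset> H"
  shows "face_rank G < face_rank H"
proof (cases "G = {}")
  case True
  then show ?thesis using assms by (auto simp: face_rank_def)
next
  case False
  then have "H \<noteq> {}" using assms by auto
  note G = face_box[OF assms(1) False] and H = face_box[OF assms(2) \<open>H \<noteq> {}\<close>]
  have "face_box G \<le> face_box H" using box_face_subset_iff G H assms by (metis psubset_imp_subset)
  moreover have "face_box G \<noteq> face_box H" using G H assms by (metis psubset_eq)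
  ultimately show ?thesis
    using box_rank_strict_mono G H False \<open>H \<noteq> {}\<close> by (simp add: face_rank_def)
qed

lemma face_rank_le: "face_rank (coord_product \<Delta>) \<le> aff_dim (coord_product \<Delta>)"
  using box_rank_le_aff_dim[OF box_U] box_face_nonempty[OF box_U] face_box_box_face[OF box_U]
  unfolding face_rank_def box_face_U[symmetric] by simp

end

section \<open>Pointed polyhedra\<close>

text \<open>Orthogonality to the complement \<open>T\<close> of \<open>V\<close> is imposed along
  with orthogonality to \<open>A\<close>: it forces the solution into \<open>V\<close>, and the
  dimensions of \<open>A\<close> and \<open>T\<close> together stay below that of the whole
  space.\<close>

lemma exists_orthogonal_in_subspace:
  fixes V :: "'a::euclidean_space set"
  assumes V: "subspace V" and A: "finite A" "card A < dim V"
  obtains w where "w \<in> V" "w \<noteq> 0" "\<And>a. a \<in> A \<Longrightarrow> a \<bullet> w = 0"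
proof -
  define T where "T = {y. \<forall>x\<in>V. orthogonal x y}"
  have T: "dim T + dim V = DIM('a)"
    using dim_subspace_orthogonal_to_vectors[of V UNIV] V by (simp add: T_def)
  have "dim (A \<union> T) \<le> dim A + dim T"
    using dim_sums_Int[OF subspace_span[of A] subspace_span[of T]]
    unfolding span_Un[symmetric] dim_span by linarith
  then have "dim (A \<union> T) < DIM('a)" using T A dim_le_card'[OF A(1)] by linarith
  then obtain w where w: "w \<noteq> 0" "\<And>y. y \<in> span (A \<union> T) \<Longrightarrow> orthogonal w y"
    using orthogonal_to_subspace_exists by blast
  have wT: "orthogonal w y" if "y \<in> T" for y using w(2) that by (simp add: span_base)
  have "w \<in> V"
  proof -
    obtain y z where yz: "y \<in> span V" "\<And>u. u \<in> span V \<Longrightarrow> orthogonal z u" "w = y + z"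
      using orthogonal_subspace_decomp_exists[of V w] by blast
    have "z \<in> T" unfolding T_def using yz(2) by (auto simp: orthogonal_commute span_base)
    then have "orthogonal w z" by (rule wT)
    moreover have "orthogonal y z" using yz by (simp add: orthogonal_commute)
    ultimately have "z \<bullet> z = 0" using yz(3) by (simp add: orthogonal_def inner_add_left)
    moreover have "span V = V" using V by (simp only: span_eq_iff)
    ultimately show ?thesis using yz(1,3) by (simp only: inner_eq_zero_iff add_0_right)
  qed
  moreover have "a \<bullet> w = 0" if "a \<in> A" for a
    using w(2)[of a] that by (simp add: span_base orthogonal_def inner_commute)
  ultimately show ?thesis using that w(1) by blast
qed

text \<open>The halfspaces are to be indexed by the facets themselves. In a minimal description
  every facet comes from some halfspace; what has to be shown is that no two halfspaces cut out the
  same facet.\<close>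

lemma polyhedron_facet_description:
  fixes P :: "'a::euclidean_space set"
  assumes P: "polyhedron P" "P \<noteq> {}"
  obtains \<alpha> \<beta> where
    "P = affine hull P \<inter> {x. \<forall>c. c facet_of P \<longrightarrow> \<alpha> c \<bullet> x \<le> (\<beta> c :: real)}"
    "\<And>c. c facet_of P \<Longrightarrow> c = P \<inter> {x. \<alpha> c \<bullet> x = \<beta> c}"
proof -
  obtain H where H: "finite H" "P = affine hull P \<inter> \<Inter>H"
    "\<forall>h\<in>H. \<exists>a b. a \<noteq> 0 \<and> h = {x. a \<bullet> x \<le> b}"
    "\<And>H'. H' \<subset> H \<Longrightarrow> P \<subset> affine hull P \<inter> \<Inter>H'"
    using P(1) unfolding polyhedron_Int_affine_minimal by meson
  obtain a b where ab: "\<And>h. h \<in> H \<Longrightarrow> a h \<noteq> 0 \<and> h = {x. a h \<bullet> x \<le> b h}"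
    using H(3) by metis
  let ?c = "\<lambda>h. P \<inter> {x. a h \<bullet> x = b h}"
  have facets: "c facet_of P \<longleftrightarrow> (\<exists>h. h \<in> H \<and> c = ?c h)" for c
    by (rule facet_of_polyhedron_explicit[OF H(1,2) ab H(4)])
  have rel: "rel_interior P = {x \<in> P. \<forall>h\<in>H. a h \<bullet> x < b h}"
    by (rule rel_interior_polyhedron_explicit[OF H(1,2) ab H(4)])
  have "rel_interior P \<noteq> {}" using P by (simp add: polyhedron_imp_convex rel_interior_eq_empty)
  then obtain p where p: "p \<in> P" "\<And>h. h \<in> H \<Longrightarrow> a h \<bullet> p < b h" using rel by blast
  \<comment> \<open>Minimality gives an \<open>x\<close> that violates \<open>k\<close> only. The
    segment from the relatively interior point \<open>p\<close> to \<open>x\<close> crosses the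
    hyperplane of \<open>k\<close> at \<open>q\<close>, where all other inequalities are strict, so
    \<open>q\<close> lies on the facet of \<open>k\<close> and of no other halfspace.\<close>
  have inj: "h = k" if h: "h \<in> H" and k: "k \<in> H" and eq: "?c h = ?c k" for h k
  proof (rule ccontr)
    assume "h \<noteq> k"
    have "P \<subset> affine hull P \<inter> \<Inter>(H - {k})" using k by (intro H(4)) auto
    then obtain x where x: "x \<in> affine hull P" "\<And>g. g \<in> H - {k} \<Longrightarrow> x \<in> g" "x \<notin> P" by blast
    have xk: "a k \<bullet> x > b k"
    proof (rule ccontr)
      assume "\<not> ?thesis"
      then have "x \<in> k" using ab[OF k] by (metis linorder_not_less mem_Collect_eq)
      then have "x \<in> P" using H(2) x(1,2) by blast
      then show False using x by simp
    qed
    define u where "u = (b k - a k \<bullet> p) / (a k \<bullet> x - a k \<bullet> p)"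
    have u: "0 \<le> u" "u < 1" unfolding u_def using p(2)[OF k] xk by (auto simp: divide_simps)
    define q where "q = (1 - u) *\<^sub>R p + u *\<^sub>R x"
    have q_inner: "a g \<bullet> q = a g \<bullet> p + u * (a g \<bullet> x - a g \<bullet> p)" for g
      by (simp add: q_def inner_add_right algebra_simps)
    have qk: "a k \<bullet> q = b k" using xk p(2)[OF k] unfolding q_inner u_def by simp
    have lt: "a g \<bullet> q < b g" if g: "g \<in> H" "g \<noteq> k" for g
    proof -
      have "a g \<bullet> x \<le> b g" using x(2)[of g] g ab[OF g(1)] by blast
      then have "u * (a g \<bullet> x) \<le> u * b g" using u by (simp add: mult_left_mono)
      moreover have "(1 - u) * (a g \<bullet> p) < (1 - u) * b g" using u p(2)[OF g(1)] by simp
      ultimately show ?thesis unfolding q_inner by (simp add: algebra_simps)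
    qed
    have "q \<in> affine hull P"
      unfolding q_def using p x by (intro mem_affine) (auto simp: hull_inc)
    moreover have "q \<in> g" if "g \<in> H" for g
    proof -
      have "a g \<bullet> q \<le> b g" using lt[OF that] qk by (cases "g = k") auto
      then show ?thesis using ab[OF that] by blast
    qed
    ultimately have "q \<in> P" using H(2) by blast
    then have "q \<in> ?c k" using qk by simp
    then have "a h \<bullet> q = b h" using eq by blast
    then show False using lt[OF h \<open>h \<noteq> k\<close>] by simp
  qed
  define g where "g c = (THE h. h \<in> H \<and> c = ?c h)" for c
  have g: "g (?c h) = h" if "h \<in> H" for h
    unfolding g_def using that inj by (intro the_equality) auto
  show ?thesis
  proof (rule that[of "\<lambda>c. a (g c)" "\<lambda>c. b (g c)"])
    fix c assume "c facet_of P"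
    then obtain h where "h \<in> H" "c = ?c h" using facets by blast
    then show "c = P \<inter> {x. a (g c) \<bullet> x = b (g c)}" using g by simp
  next
    have "(\<forall>c. c facet_of P \<longrightarrow> a (g c) \<bullet> x \<le> b (g c)) \<longleftrightarrow> (\<forall>h\<in>H. a h \<bullet> x \<le> b h)" for x
      using facets g by metis
    moreover have "(\<forall>h\<in>H. a h \<bullet> x \<le> b h) \<longleftrightarrow> x \<in> \<Inter>H" for x
      using ab by blast
    ultimately have "{x. \<forall>c. c facet_of P \<longrightarrow> a (g c) \<bullet> x \<le> b (g c)} = \<Inter>H" by blast
    then show "P = affine hull P \<inter> {x. \<forall>c. c facet_of P \<longrightarrow> a (g c) \<bullet> x \<le> b (g c)}"
      using H(2) by simp
  qed
qed

lemma extreme_point_no_segment: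
  assumes "v extreme_point_of P" "v + w \<in> P" "v - w \<in> P"
  shows "w = 0"
proof (rule ccontr)
  assume "w \<noteq> 0"
  have eq: "v = midpoint (v + w) (v - w)" by (simp add: midpoint_def flip: scaleR_2)
  have "v + w \<noteq> v - w"
  proof
    assume "v + w = v - w"
    then have "2 *\<^sub>R w = 0" by (simp add: scaleR_2 algebra_simps)
    then show False using \<open>w \<noteq> 0\<close> by simp
  qed
  then have "v \<in> open_segment (v + w) (v - w)" using eq midpoint_in_open_segment by metis
  then show False using assms by (auto simp: extreme_point_of_def)
qed

section \<open>Facets and edge directions at a vertex\<close>

locale polyhedron_vertex =
  fixes P :: "'a::euclidean_space set" and d :: nat and \<alpha> \<beta> and v :: 'a
  assumes P: "polyhedron P" and dim: "aff_dim P = int d"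
    and description: "P = affine hull P \<inter> {x. \<forall>c. c facet_of P \<longrightarrow> \<alpha> c \<bullet> x \<le> (\<beta> c :: real)}"
    and facet_eq: "\<And>c. c facet_of P \<Longrightarrow> c = P \<inter> {x. \<alpha> c \<bullet> x = \<beta> c}"
    and v: "v extreme_point_of P"
begin

text \<open>\<open>P\<close> need not be full-dimensional in its ambient space, so the linear
  algebra at \<open>v\<close> takes place in the direction space of the affine hull.\<close>

definition V :: "'a set" where "V = {w. v + w \<in> affine hull P}"

definition facets :: "'a set set" where "facets = {c. c facet_of P \<and> v \<in> c}"

lemma v_in_P: "v \<in> P"
  using v by (simp add: extreme_point_of_def)

lemma V_eq: "V = (\<lambda>x. - v + x) ` (affine hull P)"
proof
  show "V \<subseteq> (\<lambda>x. - v + x) ` (affine hull P)"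
  proof
    fix w assume "w \<in> V"
    then show "w \<in> (\<lambda>x. - v + x) ` (affine hull P)"
      by (intro image_eqI[of _ _ "v + w"]) (auto simp: V_def)
  qed
qed (auto simp: V_def)

lemma subspace_V: "subspace V"
  unfolding V_eq by (rule affine_diffs_subspace) (auto simp: v_in_P hull_inc)

lemma dim_V: "dim V = d"
proof -
  have "aff_dim (affine hull P) = int (dim ((+) (- v) ` (affine hull P)))"
    by (rule aff_dim_eq_dim) (simp add: v_in_P hull_inc)
  then show ?thesis using dim by (simp add: V_eq)
qed

lemma diff_in_V: "x \<in> P \<Longrightarrow> x - v \<in> V"
  by (simp add: V_def hull_inc)

lemma finite_facets: "finite facets"
  unfolding facets_def using finite_polyhedron_facets[OF P] by (rule rev_finite_subset) auto

lemma facetsD: "c \<in> facets \<Longrightarrow> c facet_of P" "c \<in> facets \<Longrightarrow> \<alpha> c \<bullet> v = \<beta> c"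
  using facet_eq by (auto simp: facets_def)

lemma facet_le: "c facet_of P \<Longrightarrow> x \<in> P \<Longrightarrow> \<alpha> c \<bullet> x \<le> \<beta> c"
  using description by blast

lemma mem_facet_iff: "c \<in> facets \<Longrightarrow> x \<in> P \<Longrightarrow> x \<in> c \<longleftrightarrow> \<alpha> c \<bullet> (x - v) = 0"
  using facet_eq[OF facetsD(1)] facetsD(2) by (auto simp: inner_diff_right)

lemma facets_nonpos: "c \<in> facets \<Longrightarrow> x \<in> P \<Longrightarrow> \<alpha> c \<bullet> (x - v) \<le> 0"
  using facet_le[OF facetsD(1)] facetsD(2) by (auto simp: inner_diff_right)

text \<open>Facets that miss \<open>v\<close> are strict there and remain satisfied for a short
  step, so only those through \<open>v\<close> restrict the direction.\<close>

lemma local_cone: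
  assumes w: "w \<in> V" "\<And>c. c \<in> facets \<Longrightarrow> \<alpha> c \<bullet> w \<le> 0"
  obtains \<epsilon> where "\<epsilon> > 0" "v + \<epsilon> *\<^sub>R w \<in> P"
proof -
  have ev: "\<forall>\<^sub>F \<epsilon> in at_right 0. \<alpha> c \<bullet> (v + \<epsilon> *\<^sub>R w) \<le> \<beta> c" if c: "c facet_of P" for c
  proof (cases "v \<in> c")
    case True
    then have "c \<in> facets" using c by (simp add: facets_def)
    then have "\<alpha> c \<bullet> (v + \<epsilon> *\<^sub>R w) \<le> \<beta> c" if "\<epsilon> > 0" for \<epsilon>
      using facetsD(2) w(2) that by (simp add: inner_add_right mult_nonneg_nonpos)
    then show ?thesis by (auto simp: eventually_at_right_field intro: exI[of _ 1])
  next
    case False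
    then have lt: "\<alpha> c \<bullet> v < \<beta> c"
      using facet_eq[OF c] facet_le[OF c v_in_P] v_in_P by (auto simp: less_le)
    have "((\<lambda>\<epsilon>. \<alpha> c \<bullet> (v + \<epsilon> *\<^sub>R w)) \<longlongrightarrow> \<alpha> c \<bullet> (v + 0 *\<^sub>R w)) (at_right 0)"
      by (intro tendsto_intros)
    then have "\<forall>\<^sub>F \<epsilon> in at_right 0. \<alpha> c \<bullet> (v + \<epsilon> *\<^sub>R w) < \<beta> c"
      using lt by (intro order_tendstoD(2)[of _ "\<alpha> c \<bullet> (v + 0 *\<^sub>R w)"]) auto
    then show ?thesis by (rule eventually_mono) simp
  qed
  have "\<forall>\<^sub>F \<epsilon> in at_right 0. \<forall>c\<in>{c. c facet_of P}. \<alpha> c \<bullet> (v + \<epsilon> *\<^sub>R w) \<le> \<beta> c"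
    using ev finite_polyhedron_facets[OF P] by (intro eventually_ball_finite) auto
  then obtain \<delta> where \<delta>: "\<delta> > 0" "\<And>\<epsilon> c. \<lbrakk>0 < \<epsilon>; \<epsilon> < \<delta>; c facet_of P\<rbrakk> \<Longrightarrow> \<alpha> c \<bullet> (v + \<epsilon> *\<^sub>R w) \<le> \<beta> c"
    by (auto simp: eventually_at_right_field)
  define \<epsilon> where "\<epsilon> = \<delta> / 2"
  have "\<epsilon> *\<^sub>R w \<in> V" using w(1) subspace_V by (simp add: subspace_mul)
  then have "v + \<epsilon> *\<^sub>R w \<in> affine hull P" by (simp add: V_def)
  moreover have "\<alpha> c \<bullet> (v + \<epsilon> *\<^sub>R w) \<le> \<beta> c" if "c facet_of P" for c
    using \<delta> that by (simp add: \<epsilon>_def)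
  ultimately have "v + \<epsilon> *\<^sub>R w \<in> P" using description by blast
  then show ?thesis using that \<delta>(1) by (metis \<epsilon>_def half_gt_zero)
qed

text \<open>Both \<open>w\<close> and \<open>- w\<close> satisfy \<open>local_cone\<close>, so for
  nonzero \<open>w\<close> the vertex would be the midpoint of a segment in
  \<open>P\<close>.\<close>

lemma facets_separate:
  assumes w: "w \<in> V" "\<And>c. c \<in> facets \<Longrightarrow> \<alpha> c \<bullet> w = 0"
  shows "w = 0"
proof -
  obtain \<epsilon> where \<epsilon>: "\<epsilon> > 0" "v + \<epsilon> *\<^sub>R w \<in> P" using local_cone[of w] w by auto
  obtain \<delta> where \<delta>: "\<delta> > 0" "v + \<delta> *\<^sub>R (- w) \<in> P"
    using local_cone[of "- w"] w subspace_V by (auto simp: subspace_neg)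
  have "convex P" using P by (rule polyhedron_imp_convex)
  have shrink: "v + t *\<^sub>R u \<in> P" if "0 \<le> t" "t \<le> s" "v + s *\<^sub>R u \<in> P" "s > 0" for s t u
  proof -
    have "(1 - t / s) *\<^sub>R v + (t / s) *\<^sub>R (v + s *\<^sub>R u) \<in> P"
      using \<open>convex P\<close> that v_in_P by (intro convexD_alt) auto
    then show ?thesis using that by (simp add: algebra_simps)
  qed
  define t where "t = min \<epsilon> \<delta>"
  have t: "t > 0" "t \<le> \<epsilon>" "t \<le> \<delta>" using \<epsilon> \<delta> by (auto simp: t_def)
  have "v + t *\<^sub>R w \<in> P" "v - t *\<^sub>R w \<in> P"
    using shrink[of t \<epsilon> w] shrink[of t \<delta> "- w"] t \<epsilon> \<delta> by auto
  then have "t *\<^sub>R w = 0" using extreme_point_no_segment[OF v] by blast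
  then show ?thesis using t by simp
qed

lemma card_facets_ge: "d \<le> card facets"
proof (rule ccontr)
  assume "\<not> ?thesis"
  then have "card (\<alpha> ` facets) < dim V"
    using card_image_le[OF finite_facets, of \<alpha>] dim_V by linarith
  then obtain w where "w \<in> V" "w \<noteq> 0" "\<And>a. a \<in> \<alpha> ` facets \<Longrightarrow> a \<bullet> w = 0"
    using exists_orthogonal_in_subspace[OF subspace_V] finite_facets by blast
  then show False using facets_separate by blast
qed

text \<open>With exactly \<open>d\<close> facets at \<open>v\<close>, the outer normals form a basis
  of the dual of \<open>V\<close>, and \<open>e c\<close> is the direction of the edge that leaves
  the facet \<open>c\<close> and stays in all others. The sign \<open>- 1\<close> points into
  \<open>P\<close>, since facets are given by upper bounds.\<close>

lemma dual_basis:
  assumes "card facets = d"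
  obtains e where "\<And>c. c \<in> facets \<Longrightarrow> e c \<in> V"
    "\<And>c c'. c \<in> facets \<Longrightarrow> c' \<in> facets \<Longrightarrow> \<alpha> c' \<bullet> e c = (if c' = c then - 1 else 0)"
    "\<And>w. w \<in> V \<Longrightarrow> w = (\<Sum>c\<in>facets. - (\<alpha> c \<bullet> w) *\<^sub>R e c)"
proof -
  have "\<exists>e. e \<in> V \<and> (\<forall>c'\<in>facets. \<alpha> c' \<bullet> e = (if c' = c then - 1 else 0))" if c: "c \<in> facets" for c
  proof -
    have "card (\<alpha> ` (facets - {c})) \<le> card (facets - {c})"
      by (intro card_image_le) (simp add: finite_facets)
    also have "\<dots> < card facets" using c finite_facets by (intro psubset_card_mono) auto
    finally have "card (\<alpha> ` (facets - {c})) < dim V" using assms dim_V by linarith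
    \<comment> \<open>The other \<open>d - 1\<close> normals vanish together on a nonzero
      \<open>w\<close> in \<open>V\<close>, and \<open>\<alpha> c\<close> cannot vanish there too,
      by \<open>facets_separate\<close>.\<close>
    then obtain w where w: "w \<in> V" "w \<noteq> 0" "\<And>a. a \<in> \<alpha> ` (facets - {c}) \<Longrightarrow> a \<bullet> w = 0"
      using exists_orthogonal_in_subspace[OF subspace_V] finite_facets by (metis finite_Diff finite_imageI)
    have "\<alpha> c \<bullet> w \<noteq> 0" using facets_separate[OF w(1)] w by blast
    then show ?thesis
      using w subspace_mul[OF subspace_V w(1), of "- 1 / (\<alpha> c \<bullet> w)"]
      by (intro exI[of _ "(- 1 / (\<alpha> c \<bullet> w)) *\<^sub>R w"]) auto
  qed
  then obtain e where e: "\<And>c. c \<in> facets \<Longrightarrow> e c \<in> V"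
    "\<And>c c'. c \<in> facets \<Longrightarrow> c' \<in> facets \<Longrightarrow> \<alpha> c' \<bullet> e c = (if c' = c then - 1 else 0)"
    by metis
  have "w = (\<Sum>c\<in>facets. - (\<alpha> c \<bullet> w) *\<^sub>R e c)" if w: "w \<in> V" for w
  proof -
    let ?s = "\<Sum>c\<in>facets. - (\<alpha> c \<bullet> w) *\<^sub>R e c"
    have "?s \<in> V" using e subspace_V by (intro subspace_sum subspace_mul) auto
    then have "w - ?s \<in> V" using w subspace_V by (simp add: subspace_diff)
    moreover have "\<alpha> c' \<bullet> (w - ?s) = 0" if c': "c' \<in> facets" for c'
    proof -
      have "\<alpha> c' \<bullet> ?s = (\<Sum>c\<in>facets. - (\<alpha> c \<bullet> w) * (\<alpha> c' \<bullet> e c))"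
        by (simp add: inner_sum_right)
      also have "\<dots> = (\<Sum>c\<in>facets. if c = c' then \<alpha> c \<bullet> w else 0)"
        using e(2) c' by (intro sum.cong) auto
      also have "\<dots> = \<alpha> c' \<bullet> w" using c' finite_facets by simp
      finally show ?thesis by (simp add: inner_diff_right)
    qed
    ultimately have "w - ?s = 0" by (rule facets_separate)
    then show ?thesis by simp
  qed
  then show ?thesis using that e by blast
qed

end

text \<open>Zero is excluded because it would make \<open>bounded_face\<close> fail for every
  nonempty face, and because a functional is to be strictly positive on these directions.\<close>

definition recession_directions :: "'a::real_vector set \<Rightarrow> 'a set" where
  "recession_directions P = {r. r \<noteq> 0 \<and> (\<forall>x\<in>P. \<forall>t\<ge>0. x + t *\<^sub>R r \<in> P)}"

lemma polyhedron_halfspaces: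
  fixes P :: "'a::euclidean_space set"
  assumes "polyhedron P"
  obtains H :: "'a set set" and a b where "finite H" "P = {x. \<forall>h\<in>H. a h \<bullet> x \<le> (b h :: real)}"
proof -
  obtain H where H: "finite H" "P = \<Inter>H" "\<forall>h\<in>H. \<exists>a b. a \<noteq> 0 \<and> h = {x. a \<bullet> x \<le> b}"
    using assms by (auto simp: polyhedron_def)
  obtain a b where ab: "\<And>h. h \<in> H \<Longrightarrow> h = {x. a h \<bullet> x \<le> b h}"
    using H(3) by metis
  have "P = {x. \<forall>h\<in>H. a h \<bullet> x \<le> b h}" using H(2) ab by blast
  then show ?thesis using that H(1) by blast
qed

lemma ray_slope_nonpos:
  fixes a x r :: "'a::real_inner"
  assumes "\<And>t. t \<ge> 0 \<Longrightarrow> a \<bullet> (x + t *\<^sub>R r) \<le> b"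
  shows "a \<bullet> r \<le> 0"
proof (rule ccontr)
  assume "\<not> ?thesis"
  then have pos: "a \<bullet> r > 0" by simp
  define t where "t = (\<bar>b - a \<bullet> x\<bar> + 1) / (a \<bullet> r)"
  have "t \<ge> 0" using pos by (simp add: t_def)
  moreover have "a \<bullet> (x + t *\<^sub>R r) = a \<bullet> x + \<bar>b - a \<bullet> x\<bar> + 1"
    using pos by (simp add: t_def inner_add_right)
  ultimately show False using assms[of t] by linarith
qed

text \<open>A ray that stays in \<open>P\<close> has nonpositive slope in every defining inequality,
  and these slopes do not depend on the base point.\<close>

lemma ray_imp_recession_direction:
  fixes P :: "'a::euclidean_space set"
  assumes P: "polyhedron P" and r: "r \<noteq> 0" "\<And>t. t \<ge> 0 \<Longrightarrow> x + t *\<^sub>R r \<in> P"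
  shows "r \<in> recession_directions P"
proof -
  obtain H a b where H: "finite (H :: 'a set set)" "P = {x. \<forall>h\<in>H. a h \<bullet> x \<le> (b h :: real)}"
    using polyhedron_halfspaces[OF P] by blast
  have "a h \<bullet> r \<le> 0" if "h \<in> H" for h
    using r(2) that unfolding H(2) by (intro ray_slope_nonpos[of "a h" x r "b h"]) auto
  then show ?thesis using r(1) unfolding recession_directions_def H(2)
    by (auto simp: inner_add_right) (smt (verit) mult_nonneg_nonpos)
qed

text \<open>Both directions of a line are recession directions, so the line can be moved to the
  vertex, which would then be interior to a segment.\<close>

lemma pointed_no_line:
  fixes P :: "'a::euclidean_space set"
  assumes P: "polyhedron P" and v: "v extreme_point_of P" and r: "\<And>t. x + t *\<^sub>R r \<in> P"
  shows "r = 0"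
proof (rule ccontr)
  assume "r \<noteq> 0"
  have "r \<in> recession_directions P" by (rule ray_imp_recession_direction[OF P \<open>r \<noteq> 0\<close> r])
  moreover have "- r \<in> recession_directions P"
    using \<open>r \<noteq> 0\<close> r[of "- _"] by (intro ray_imp_recession_direction[OF P]) auto
  moreover have "v \<in> P" using v by (simp add: extreme_point_of_def)
  ultimately have "v + 1 *\<^sub>R r \<in> P" "v + 1 *\<^sub>R (- r) \<in> P"
    unfolding recession_directions_def by (metis (mono_tags, lifting) mem_Collect_eq zero_le_one)+
  then show False using extreme_point_no_segment[OF v, of r] \<open>r \<noteq> 0\<close> by simp
qed

text \<open>With an empty relative frontier \<open>F\<close> would be affine, and an affine set of
  positive dimension contains a line.\<close>

lemma pointed_face_has_facet:
  fixes P :: "'a::euclidean_space set"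
  assumes P: "polyhedron P" and v: "v extreme_point_of P"
    and F: "F face_of P" "aff_dim F > 0"
  obtains C where "C facet_of F"
proof -
  have "\<not> (\<exists>x. F \<subseteq> {x})" using F(2) by (metis aff_dim_empty aff_dim_sing less_irrefl not_less_iff_gr_or_eq subset_singletonD neg_less_0_iff_less zero_less_one)
  then obtain x y where xy: "x \<in> F" "y \<in> F" "x \<noteq> y" by blast
  have "\<not> affine F"
  proof
    assume "affine F"
    have "x + t *\<^sub>R (y - x) \<in> P" for t
    proof -
      have "(1 - t) *\<^sub>R x + t *\<^sub>R y \<in> F" using \<open>affine F\<close> xy by (simp add: affine_alt)
      moreover have "(1 - t) *\<^sub>R x + t *\<^sub>R y = x + t *\<^sub>R (y - x)" by (simp add: algebra_simps)
      ultimately show ?thesis using face_of_imp_subset[OF F(1)] by auto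
    qed
    then have "y - x = 0" by (rule pointed_no_line[OF P v])
    then show False using xy by simp
  qed
  then have "rel_frontier F \<noteq> {}" by (simp add: rel_frontier_eq_empty)
  then show ?thesis
    using that rel_frontier_of_polyhedron[OF face_of_polyhedron_polyhedron[OF P F(1)]] by auto
qed

text \<open>One step of a chain that ends at the empty face; this is the subface of a point and has
  dimension -1, so the uniform drop by one includes it.\<close>

lemma pointed_face_has_subface:
  fixes P :: "'a::euclidean_space set"
  assumes P: "polyhedron P" and v: "v extreme_point_of P"
    and F: "F face_of P" "F \<noteq> {}"
  obtains C where "C face_of P" "C \<subset> F" "aff_dim C = aff_dim F - 1"
proof (cases "aff_dim F > 0")
  case True
  then obtain C where C: "C facet_of F" using pointed_face_has_facet[OF P v F(1)] by blast
  then have "C face_of P" using F(1) face_of_trans facet_of_imp_face_of by blast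
  moreover have "C \<noteq> F" using C by (auto simp: facet_of_def)
  ultimately show ?thesis using that C by (auto simp: facet_of_def dest: face_of_imp_subset)
next
  case False
  then have "aff_dim F = 0" using F(2) aff_dim_negative_iff[of F] by linarith
  then show ?thesis using that[of "{}"] F(2) by auto
qed

lemma pointed_face_has_vertex:
  fixes P :: "'a::euclidean_space set"
  assumes P: "polyhedron P" and v: "v extreme_point_of P"
    and F: "F face_of P" "F \<noteq> {}"
  obtains w where "w \<in> F" "w extreme_point_of P"
proof -
  have "\<exists>w\<in>F. w extreme_point_of P" using F
  proof (induction "nat (aff_dim F)" arbitrary: F rule: less_induct)
    case less
    show ?case
    proof (cases "aff_dim F > 0")
      case True
      then obtain C where C: "C facet_of F" using pointed_face_has_facet[OF P v less.prems(1)] by blast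
      then have "C face_of P" using less.prems(1) face_of_trans facet_of_imp_face_of by blast
      moreover have "C \<noteq> {}" "nat (aff_dim C) < nat (aff_dim F)" using C True by (auto simp: facet_of_def)
      ultimately have "\<exists>w\<in>C. w extreme_point_of P" using less.hyps by blast
      then show ?thesis using C facet_of_imp_subset by blast
    next
      case False
      then have "aff_dim F = 0" using less.prems(2) aff_dim_negative_iff[of F] by linarith
      then obtain w where "F = {w}" by (auto simp: aff_dim_eq_0)
      then show ?thesis using less.prems(1) by (simp add: face_of_singleton)
    qed
  qed
  then show ?thesis using that by blast
qed

lemma polyhedron_minimal_face:
  fixes P :: "'a::euclidean_space set"
  assumes P: "polyhedron P" and y: "y \<in> P"
  obtains F where "F face_of P" "y \<in> rel_interior F"
proof -
  have "\<exists>F. F face_of P \<and> y \<in> rel_interior F"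
    using P y
  proof (induction "nat (aff_dim P + 1)" arbitrary: P rule: less_induct)
    case less
    show ?case
    proof (cases "y \<in> rel_interior P")
      case True
      then show ?thesis using less.prems(1) polyhedron_imp_convex face_of_refl by blast
    next
      case False
      then obtain C where C: "C facet_of P" "y \<in> C"
        using rel_boundary_of_polyhedron[OF less.prems(1)] less.prems(2) by blast
      have "polyhedron C"
        using C less.prems(1) face_of_polyhedron_polyhedron facet_of_imp_face_of by blast
      moreover have "nat (aff_dim C + 1) < nat (aff_dim P + 1)"
        using C aff_dim_geq[of C] by (auto simp: facet_of_def)
      ultimately obtain F where "F face_of C" "y \<in> rel_interior F"
        using less.hyps C by blast
      then show ?thesis using C face_of_trans facet_of_imp_face_of by blast
    qed
  qed
  then show ?thesis using that by blast
qed

lemma rel_interior_backward: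
  fixes F :: "'a::euclidean_space set"
  assumes y: "y \<in> rel_interior F" and x: "x \<in> F" "x + r \<in> F"
  obtains \<epsilon> where "\<epsilon> > 0" "y - \<epsilon> *\<^sub>R r \<in> F"
proof -
  obtain \<delta> where \<delta>: "\<delta> > 0" "y \<in> F" "ball y \<delta> \<inter> affine hull F \<subseteq> F"
    using y by (auto simp: mem_rel_interior_ball)
  \<comment> \<open>The summand 1 keeps the denominator positive when \<open>r = 0\<close>.\<close>
  define \<epsilon> where "\<epsilon> = \<delta> / (2 * (norm r + 1))"
  have \<epsilon>: "\<epsilon> > 0" unfolding \<epsilon>_def using \<delta>(1) by (auto intro!: divide_pos_pos add_nonneg_pos)
  have "norm (\<epsilon> *\<^sub>R r) < \<delta>"
  proof -
    have "norm (\<epsilon> *\<^sub>R r) = \<epsilon> * norm r" using \<epsilon> by simp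
    also have "\<dots> \<le> \<epsilon> * (norm r + 1)" using \<epsilon> by simp
    also have "\<dots> = \<delta> / 2"
    proof -
      have "norm r + 1 \<noteq> 0" using norm_ge_zero[of r] by linarith
      then show ?thesis by (simp only: \<epsilon>_def) (simp add: divide_simps)
    qed
    finally show ?thesis using \<delta>(1) by linarith
  qed
  then have "y - \<epsilon> *\<^sub>R r \<in> ball y \<delta>" by (simp add: dist_norm)
  moreover have "y - \<epsilon> *\<^sub>R r \<in> affine hull F"
  proof -
    have "y + (- \<epsilon>) *\<^sub>R ((x + r) - x) \<in> affine hull F"
      using \<delta>(2) x by (intro mem_affine_3_minus affine_affine_hull) (auto simp: hull_inc)
    then show ?thesis by simp
  qed
  ultimately show ?thesis using that \<epsilon> \<delta>(3) by blast
qed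

text \<open>For a face \<open>F\<close> of a polyhedron \<open>P\<close>, this is equivalent to boundedness of \<open>F\<close>.\<close>

definition bounded_face :: "'a::real_vector set \<Rightarrow> 'a set \<Rightarrow> bool" where
  "bounded_face P F \<longleftrightarrow> \<not> (\<exists>r\<in>recession_directions P. \<exists>x\<in>F. x + r \<in> F)"

section \<open>Pushing points backwards along recession directions\<close>

lemma continuous_on_Min:
  fixes f :: "'i \<Rightarrow> 'a::topological_space \<Rightarrow> real"
  assumes "finite I" "I \<noteq> {}" "\<And>i. i \<in> I \<Longrightarrow> continuous_on S (f i)"
  shows "continuous_on S (\<lambda>x. Min ((\<lambda>i. f i x) ` I))"
  using assms
proof (induction I rule: finite_ne_induct)
  case (insert i I)
  then have "continuous_on S (\<lambda>x. min (f i x) (Min ((\<lambda>i. f i x) ` I)))"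
    by (intro continuous_on_min) auto
  moreover have "Min ((\<lambda>i. f i x) ` insert i I) = min (f i x) (Min ((\<lambda>i. f i x) ` I))" for x
    using insert by simp
  ultimately show ?case by simp
qed simp

text \<open>\<open>t x\<close> is the longest move along \<open>- r\<close> inside \<open>P\<close>.
  It is finite because a pointed polyhedron contains no line, and continuous because it is a minimum
  of finitely many affine functions.\<close>

lemma recession_push:
  fixes P :: "'a::euclidean_space set"
  assumes P: "polyhedron P" and v: "v extreme_point_of P" and r: "r \<in> recession_directions P"
  obtains t where "continuous_on P t" "\<And>x. x \<in> P \<Longrightarrow> t x \<ge> (0::real)"
    "\<And>x. x \<in> P \<Longrightarrow> x - t x *\<^sub>R r \<in> P"
    "\<And>x \<epsilon>. x \<in> P \<Longrightarrow> \<epsilon> > 0 \<Longrightarrow> x - t x *\<^sub>R r - \<epsilon> *\<^sub>R r \<notin> P"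
proof -
  obtain H a b where H: "finite (H :: 'a set set)" "P = {x. \<forall>h\<in>H. a h \<bullet> x \<le> (b h :: real)}"
    using polyhedron_halfspaces[OF P] by blast
  have vP: "v \<in> P" using v by (simp add: extreme_point_of_def)
  have r0: "r \<noteq> 0" and ray: "\<And>x t. x \<in> P \<Longrightarrow> t \<ge> 0 \<Longrightarrow> x + t *\<^sub>R r \<in> P"
    using r by (auto simp: recession_directions_def)
  have le: "a h \<bullet> r \<le> 0" if "h \<in> H" for h
    using ray[OF vP] that unfolding H(2) by (intro ray_slope_nonpos[of "a h" v r "b h"]) auto
  define I where "I = {h\<in>H. a h \<bullet> r < 0}"
  have finI: "finite I" using H(1) by (simp add: I_def)
  have "I \<noteq> {}"
  proof
    assume "I = {}"
    then have "a h \<bullet> r = 0" if "h \<in> H" for h using le that unfolding I_def by force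
    then have "v + t *\<^sub>R r \<in> P" for t using vP unfolding H(2) by (simp add: inner_add_right)
    then show False using pointed_no_line[OF P v] r0 by blast
  qed
  \<comment> \<open>The length of the move along \<open>- r\<close> at which the inequality
    \<open>h\<close> becomes tight.\<close>
  define s where "s h x = (b h - a h \<bullet> x) / (- (a h \<bullet> r))" for h x
  define t where "t x = Min ((\<lambda>h. s h x) ` I)" for x
  have t_le: "t x \<le> s h x" if "h \<in> I" for h x
    unfolding t_def using finI that by (intro Min_le) auto
  have t_attained: "\<exists>h\<in>I. t x = s h x" for x
  proof -
    have "t x \<in> (\<lambda>h. s h x) ` I" unfolding t_def using finI \<open>I \<noteq> {}\<close> by (intro Min_in) auto
    then show ?thesis by auto
  qed
  show ?thesis
  proof (rule that[of t])
    show "continuous_on P t"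
      unfolding t_def using finI \<open>I \<noteq> {}\<close>
      by (intro continuous_on_Min) (auto simp: s_def I_def intro!: continuous_intros)
    show "t x \<ge> 0" if "x \<in> P" for x
    proof -
      obtain h where "h \<in> I" "t x = s h x" using t_attained by blast
      then show ?thesis using that unfolding H(2) s_def I_def by (auto intro!: divide_nonneg_neg)
    qed
    show "x - t x *\<^sub>R r \<in> P" if x: "x \<in> P" for x
    proof -
      have "a h \<bullet> (x - t x *\<^sub>R r) \<le> b h" if h: "h \<in> H" for h
      proof (cases "h \<in> I")
        case True
        then have "a h \<bullet> r < 0" by (simp add: I_def)
        then have "t x * (- (a h \<bullet> r)) \<le> b h - a h \<bullet> x"
          using t_le[OF True, of x] unfolding s_def by (subst (asm) pos_le_divide_eq) auto
        then show ?thesis by (simp add: inner_diff_right)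
      next
        case False
        then have "a h \<bullet> r = 0" using le[OF h] h by (simp add: I_def)
        then show ?thesis using x h unfolding H(2) by (simp add: inner_diff_right)
      qed
      then show ?thesis unfolding H(2) by blast
    qed
    show "x - t x *\<^sub>R r - \<epsilon> *\<^sub>R r \<notin> P" if "x \<in> P" "\<epsilon> > 0" for x \<epsilon>
    proof
      assume *: "x - t x *\<^sub>R r - \<epsilon> *\<^sub>R r \<in> P"
      obtain h where h: "h \<in> I" "t x = s h x" using t_attained by blast
      then have neg: "a h \<bullet> r < 0" by (simp add: I_def)
      have "a h \<bullet> (x - t x *\<^sub>R r - \<epsilon> *\<^sub>R r) = b h - \<epsilon> * (a h \<bullet> r)"
      proof -
        have "t x * (a h \<bullet> r) = a h \<bullet> x - b h" using h neg by (simp add: s_def field_simps)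
        then show ?thesis by (simp add: inner_diff_right)
      qed
      also have "\<dots> > b h" using neg that by (simp add: mult_pos_neg)
      finally show False using * h(1) unfolding H(2) I_def by force
    qed
  qed
qed

text \<open>\<open>x\<close> is the midpoint of \<open>y\<close> and
  \<open>x + t *\<^sub>R r\<close>, both in \<open>P\<close>, so a face that contains
  \<open>x\<close> contains \<open>y\<close>.\<close>

lemma face_of_push:
  assumes F: "F face_of P" "x \<in> F" and y: "y \<in> P" and r: "r \<in> recession_directions P"
    and x: "x = y + t *\<^sub>R r" "t \<ge> (0::real)"
  shows "y \<in> F"
proof (cases "t = 0")
  case False
  have "x + t *\<^sub>R r \<in> P"
    using r F face_of_imp_subset[OF F(1)] x(2) by (auto simp: recession_directions_def)
  moreover have eq: "x = midpoint y (x + t *\<^sub>R r)"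
    using x(1) by (simp add: midpoint_def algebra_simps flip: scaleR_2)
  moreover have "y \<noteq> x + t *\<^sub>R r"
  proof
    assume "y = x + t *\<^sub>R r"
    then have "(2 * t) *\<^sub>R r = 0" using x(1) by (simp add: scaleR_2 algebra_simps flip: scaleR_scaleR)
    then show False using False r by (simp add: recession_directions_def)
  qed
  ultimately have "x \<in> open_segment y (x + t *\<^sub>R r)" using midpoint_in_open_segment by metis
  then show ?thesis using face_ofD[OF F(1) _ y \<open>x + t *\<^sub>R r \<in> P\<close>] F(2) by blast
qed (use F x in simp)

text \<open>One push per direction suffices. A later push does not reopen an exhausted direction
  \<open>q\<close>: if a step along \<open>- q\<close> stayed in \<open>P\<close> after the push
  along \<open>- r\<close>, adding back the multiple of \<open>r\<close> would give such a step
  before it.\<close>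

lemma multi_recession_push:
  fixes P :: "'a::euclidean_space set"
  assumes P: "polyhedron P" and v: "v extreme_point_of P"
    and R: "finite R" "R \<subseteq> recession_directions P"
  shows "\<exists>\<rho>. continuous_on P \<rho> \<and> \<rho> \<in> P \<rightarrow> P \<and> (\<forall>F x. F face_of P \<longrightarrow> x \<in> F \<longrightarrow> \<rho> x \<in> F) \<and>
     (\<forall>x\<in>P. \<forall>r\<in>R. \<forall>\<epsilon>>0. \<rho> x - \<epsilon> *\<^sub>R r \<notin> P)"
  using R
proof (induction R)
  case empty
  show ?case by (rule exI[of _ "\<lambda>x. x"]) auto
next
  case (insert r R)
  then obtain \<rho> where \<rho>: "continuous_on P \<rho>" "\<rho> \<in> P \<rightarrow> P" "\<And>F x. F face_of P \<Longrightarrow> x \<in> F \<Longrightarrow> \<rho> x \<in> F"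
    "\<And>x r \<epsilon>. x \<in> P \<Longrightarrow> r \<in> R \<Longrightarrow> \<epsilon> > 0 \<Longrightarrow> \<rho> x - \<epsilon> *\<^sub>R r \<notin> P"
    by auto
  have r: "r \<in> recession_directions P" using insert by auto
  obtain t where t: "continuous_on P t" "\<And>x. x \<in> P \<Longrightarrow> t x \<ge> (0::real)"
    "\<And>x. x \<in> P \<Longrightarrow> x - t x *\<^sub>R r \<in> P"
    "\<And>x \<epsilon>. x \<in> P \<Longrightarrow> \<epsilon> > 0 \<Longrightarrow> x - t x *\<^sub>R r - \<epsilon> *\<^sub>R r \<notin> P"
    using recession_push[OF P v r] by blast
  define \<sigma> where "\<sigma> x = \<rho> x - t (\<rho> x) *\<^sub>R r" for x
  have \<rho>P: "\<rho> x \<in> P" if "x \<in> P" for x using \<rho>(2) that by auto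
  have "continuous_on P \<sigma>"
    unfolding \<sigma>_def using \<rho>(1) \<rho>P t(1)
    by (intro continuous_intros continuous_on_compose2[OF t(1)]) auto
  moreover have "\<sigma> \<in> P \<rightarrow> P" using t(3) \<rho>P by (auto simp: \<sigma>_def)
  moreover have "\<sigma> x \<in> F" if F: "F face_of P" "x \<in> F" for F x
  proof -
    have "x \<in> P" using F face_of_imp_subset by blast
    then show ?thesis
      using t \<rho>P by (intro face_of_push[OF F(1) \<rho>(3)[OF F] _ r, of _ "t (\<rho> x)"]) (auto simp: \<sigma>_def)
  qed
  moreover have "\<sigma> x - \<epsilon> *\<^sub>R q \<notin> P" if x: "x \<in> P" and q: "q \<in> insert r R" and \<epsilon>: "\<epsilon> > 0" for x q \<epsilon>
  proof (cases "q = r")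
    case True
    then show ?thesis using t(4)[OF \<rho>P[OF x] \<epsilon>] by (simp add: \<sigma>_def)
  next
    case False
    show ?thesis
    proof
      assume "\<sigma> x - \<epsilon> *\<^sub>R q \<in> P"
      then have "(\<sigma> x - \<epsilon> *\<^sub>R q) + t (\<rho> x) *\<^sub>R r \<in> P"
        using r t(2)[OF \<rho>P[OF x]] by (auto simp: recession_directions_def)
      then have "\<rho> x - \<epsilon> *\<^sub>R q \<in> P" by (simp add: \<sigma>_def algebra_simps)
      then show False using \<rho>(4)[OF x _ \<epsilon>] q False by blast
    qed
  qed
  ultimately show ?case by blast
qed

text \<open>Pushing every point backwards along one recession direction of each unbounded face moves
  it into the union of the bounded faces.\<close>

lemma push_to_bounded_faces:
  fixes P :: "'a::euclidean_space set"
  assumes P: "polyhedron P" and v: "v extreme_point_of P"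
  obtains \<rho> where "continuous_on P \<rho>" "\<rho> \<in> P \<rightarrow> P" "\<And>F x. F face_of P \<Longrightarrow> x \<in> F \<Longrightarrow> \<rho> x \<in> F"
    "\<And>x F. x \<in> P \<Longrightarrow> F face_of P \<Longrightarrow> \<rho> x \<in> rel_interior F \<Longrightarrow> bounded_face P F"
proof -
  define B where "B = {F. F face_of P \<and> \<not> bounded_face P F}"
  have "\<forall>F\<in>B. \<exists>r\<in>recession_directions P. \<exists>x\<in>F. x + r \<in> F"
    by (auto simp: B_def bounded_face_def)
  then obtain r where r: "\<And>F. F \<in> B \<Longrightarrow> r F \<in> recession_directions P \<and> (\<exists>x\<in>F. x + r F \<in> F)"
    by metis
  have "finite B" unfolding B_def using finite_polyhedron_faces[OF P] by (rule rev_finite_subset) auto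
  then obtain \<rho> where \<rho>: "continuous_on P \<rho>" "\<rho> \<in> P \<rightarrow> P" "\<And>F x. F face_of P \<Longrightarrow> x \<in> F \<Longrightarrow> \<rho> x \<in> F"
    "\<And>x q \<epsilon>. x \<in> P \<Longrightarrow> q \<in> r ` B \<Longrightarrow> \<epsilon> > 0 \<Longrightarrow> \<rho> x - \<epsilon> *\<^sub>R q \<notin> P"
    using multi_recession_push[OF P v, of "r ` B"] r by blast
  show ?thesis
  proof (rule that[OF \<rho>(1,2,3)])
    fix x F assume x: "x \<in> P" and F: "F face_of P" "\<rho> x \<in> rel_interior F"
    show "bounded_face P F"
    proof (rule ccontr)
      assume "\<not> ?thesis"
      then have FB: "F \<in> B" using F by (simp add: B_def)
      then obtain y where "y \<in> F" "y + r F \<in> F" using r by blast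
      \<comment> \<open>A relatively interior point of an unbounded face could still step back along
        \<open>r F\<close>, which the push has exhausted.\<close>
      then obtain \<epsilon> where "\<epsilon> > 0" "\<rho> x - \<epsilon> *\<^sub>R r F \<in> F" using rel_interior_backward[OF F(2)] by blast
      then show False using \<rho>(4)[OF x] FB face_of_imp_subset[OF F(1)] by blast
    qed
  qed
qed

section \<open>Generic linear functionals\<close>

lemma generic_positive_weights:
  fixes c :: "'i \<Rightarrow> 'z \<Rightarrow> real"
  assumes "finite I" "finite D" "\<And>z. z \<in> D \<Longrightarrow> \<exists>i\<in>I. c i z \<noteq> 0"
  shows "\<exists>\<kappa>. (\<forall>i\<in>I. \<kappa> i > (0::real)) \<and> (\<forall>z\<in>D. (\<Sum>i\<in>I. \<kappa> i * c i z) \<noteq> 0)"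
  using assms(2,3)
proof (induction D)
  case empty
  show ?case by (rule exI[of _ "\<lambda>_. 1"]) auto
next
  case (insert z D)
  then obtain \<mu> where \<mu>: "\<And>i. i \<in> I \<Longrightarrow> \<mu> i > (0::real)" "\<And>z. z \<in> D \<Longrightarrow> (\<Sum>i\<in>I. \<mu> i * c i z) \<noteq> 0"
    by auto
  have "\<exists>i\<in>I. c i z \<noteq> 0" using insert.prems by simp
  then obtain i where i: "i \<in> I" "c i z \<noteq> 0" by blast
  \<comment> \<open>The increments of the weight at \<open>i\<close> for which some sum would
    vanish. Where \<open>c i y = 0\<close>, the quotient is 0 by convention, which excludes no
    positive increment.\<close>
  let ?bad = "(\<lambda>y. - (\<Sum>j\<in>I. \<mu> j * c j y) / c i y) ` insert z D"
  have "infinite ({0<..} - ?bad)"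
    using insert infinite_Ioi[of "0::real"] by (simp add: Diff_infinite_finite)
  then have "{0<..} - ?bad \<noteq> {}" by (metis finite.emptyI)
  then obtain \<epsilon> where \<epsilon>: "\<epsilon> > 0" "\<epsilon> \<notin> ?bad" by auto
  define \<nu> where "\<nu> = \<mu>(i := \<mu> i + \<epsilon>)"
  have sum: "(\<Sum>j\<in>I. \<nu> j * c j y) = (\<Sum>j\<in>I. \<mu> j * c j y) + \<epsilon> * c i y" for y
    using assms(1) i(1) by (simp add: \<nu>_def sum.remove[of I i] algebra_simps)
  have "(\<Sum>j\<in>I. \<nu> j * c j y) \<noteq> 0" if y: "y \<in> insert z D" for y
  proof (cases "c i y = 0")
    case True
    then have "y \<in> D" using y i by auto
    then show ?thesis unfolding sum using True \<mu>(2) by simp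
  next
    case False
    have "\<epsilon> \<noteq> - (\<Sum>j\<in>I. \<mu> j * c j y) / c i y" using \<epsilon>(2) y by blast
    then show ?thesis unfolding sum using False by (simp add: field_simps)
  qed
  moreover have "\<nu> j > 0" if "j \<in> I" for j using \<mu>(1) that \<epsilon> by (auto simp: \<nu>_def add_pos_pos)
  ultimately show ?case by blast
qed

text \<open>Every constraint normal is nonpositive on recession directions, and pointedness keeps
  them from vanishing together, so the negative of a positive combination is positive there. Generic
  weights make it injective on the vertices.\<close>

lemma generic_functional:
  fixes P :: "'a::euclidean_space set"
  assumes P: "polyhedron P" and v: "v extreme_point_of P"
  obtains \<phi> where "\<And>r. r \<in> recession_directions P \<Longrightarrow> \<phi> \<bullet> r > 0" "inj_on (\<lambda>x. \<phi> \<bullet> x) (vertices P)"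
proof -
  obtain H a b where H: "finite (H :: 'a set set)" "P = {x. \<forall>h\<in>H. a h \<bullet> x \<le> (b h :: real)}"
    using polyhedron_halfspaces[OF P] by blast
  have vP: "v \<in> P" using v by (simp add: extreme_point_of_def)
  have nz: "\<exists>h\<in>H. a h \<bullet> z \<noteq> 0" if "z \<noteq> 0" for z
  proof (rule ccontr)
    assume "\<not> ?thesis"
    then have "v + t *\<^sub>R z \<in> P" for t using vP unfolding H(2) by (simp add: inner_add_right)
    then show False using pointed_no_line[OF P v] that by blast
  qed
  define D where "D = (\<lambda>(x, y). x - y) ` (vertices P \<times> vertices P) - {0}"
  have "finite D"
    using finite_polyhedron_extreme_points[OF P] by (simp add: D_def vertices_def)
  then have "\<exists>\<kappa>. (\<forall>h\<in>H. \<kappa> h > (0::real)) \<and> (\<forall>z\<in>D. (\<Sum>h\<in>H. \<kappa> h * (a h \<bullet> z)) \<noteq> 0)"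
    using nz by (intro generic_positive_weights[OF H(1)]) (auto simp: D_def)
  then obtain \<mu> where \<mu>: "\<And>h. h \<in> H \<Longrightarrow> \<mu> h > (0::real)"
    "\<And>z. z \<in> D \<Longrightarrow> (\<Sum>h\<in>H. \<mu> h * (a h \<bullet> z)) \<noteq> 0" by blast
  define \<phi> where "\<phi> = - (\<Sum>h\<in>H. \<mu> h *\<^sub>R a h)"
  have \<phi>: "\<phi> \<bullet> z = (\<Sum>h\<in>H. \<mu> h * - (a h \<bullet> z))" for z
    by (simp add: \<phi>_def inner_sum_left sum_negf)
  show ?thesis
  proof (rule that)
    fix r assume r: "r \<in> recession_directions P"
    then have "r \<noteq> 0" and ray: "\<And>t. t \<ge> 0 \<Longrightarrow> v + t *\<^sub>R r \<in> P"
      using vP by (auto simp: recession_directions_def)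
    have le: "a h \<bullet> r \<le> 0" if "h \<in> H" for h
      using ray that unfolding H(2) by (intro ray_slope_nonpos[of "a h" v r "b h"]) auto
    obtain h where h: "h \<in> H" "a h \<bullet> r \<noteq> 0" using nz[OF \<open>r \<noteq> 0\<close>] by blast
    show "\<phi> \<bullet> r > 0" unfolding \<phi>
    proof (rule sum_pos2[OF H(1) h(1)])
      show "0 < \<mu> h * - (a h \<bullet> r)" using \<mu>(1)[OF h(1)] le[OF h(1)] h(2) by (intro mult_pos_pos) auto
      show "0 \<le> \<mu> k * - (a k \<bullet> r)" if "k \<in> H" for k
        using \<mu>(1)[OF that] le[OF that] by (intro mult_nonneg_nonneg) auto
    qed
  next
    show "inj_on (\<lambda>x. \<phi> \<bullet> x) (vertices P)"
    proof (rule inj_onI, rule ccontr)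
      fix x y assume xy: "x \<in> vertices P" "y \<in> vertices P" "\<phi> \<bullet> x = \<phi> \<bullet> y" "x \<noteq> y"
      have "x - y \<in> D" unfolding D_def using xy by force
      then have "(\<Sum>h\<in>H. \<mu> h * (a h \<bullet> (x - y))) \<noteq> 0" by (rule \<mu>(2))
      moreover have "(\<Sum>h\<in>H. \<mu> h * (a h \<bullet> (x - y))) = - (\<phi> \<bullet> (x - y))"
        unfolding \<phi> by (simp add: sum_negf)
      ultimately show False using xy(3) by (simp add: inner_diff_right)
    qed
  qed
qed

section \<open>Prism-like polyhedra\<close>

text \<open>The vertex \<open>v\<^sub>0\<close> makes \<open>P\<close> pointed, so that chains of
  faces reach down to the empty face. Without a vertex, \<open>b_set\<close> is empty, a case that
  the theorem settles separately.\<close>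

locale prism_like = prism \<Delta>
  for \<Delta> :: "'m::finite \<Rightarrow> 'b::euclidean_space set" +
  fixes P :: "'a::euclidean_space set" and f :: "'a set \<Rightarrow> ('b ^ 'm) set" and d :: nat and v\<^sub>0 :: 'a
  assumes polyhedron: "polyhedron P" and aff_dim_P: "aff_dim P = int d"
    and aff_dim_prism: "aff_dim (coord_product \<Delta>) = int d"
    and injection: "face_lattice_injection P (coord_product \<Delta>) f"
    and pointed: "v\<^sub>0 extreme_point_of P"
begin

section \<open>Dimensions and ranks under the face map\<close>

definition bx :: "'a set \<Rightarrow> 'm \<Rightarrow> 'b set" where
  "bx F = face_box (f F)"

lemma f_face_of: "F face_of P \<Longrightarrow> f F face_of coord_product \<Delta>"
  using injection by (auto simp: face_lattice_injection_def face_lattice_def Pi_iff)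

lemma f_mono: "\<lbrakk>F face_of P; G face_of P; F \<subseteq> G\<rbrakk> \<Longrightarrow> f F \<subseteq> f G"
  using injection by (auto simp: face_lattice_injection_def face_lattice_def mono_on_def)

lemma f_inj: "\<lbrakk>F face_of P; G face_of P; f F = f G\<rbrakk> \<Longrightarrow> F = G"
  using injection by (auto simp: face_lattice_injection_def face_lattice_def inj_on_def)

lemma face_rank_f_strict_mono:
  assumes "F face_of P" "G face_of P" "F \<subset> G"
  shows "face_rank (f F) < face_rank (f G)"
  using assms f_mono[of F G] f_inj[of F G]
  by (intro face_rank_strict_mono f_face_of) auto

lemma convex_P: "convex P"
  using polyhedron by (rule polyhedron_imp_convex)

lemma P_face: "P face_of P"
  using convex_P by (rule face_of_refl)

text \<open>Each step up a chain from the empty face raises the dimension by one and the rank by at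
  least one.\<close>

lemma aff_dim_le_face_rank:
  assumes "F face_of P"
  shows "aff_dim F \<le> face_rank (f F)"
  using assms
proof (induction "nat (aff_dim F + 1)" arbitrary: F rule: less_induct)
  case less
  show ?case
  proof (cases "F = {}")
    case True
    then show ?thesis by (simp add: face_rank_def)
  next
    case False
    then obtain C where C: "C face_of P" "C \<subset> F" "aff_dim C = aff_dim F - 1"
      using pointed_face_has_subface[OF polyhedron pointed less.prems] by blast
    have "aff_dim F \<ge> 0" using False aff_dim_negative_iff[of F] by linarith
    then have "aff_dim C \<le> face_rank (f C)" using C by (intro less.hyps) auto
    then show ?thesis using face_rank_f_strict_mono[OF C(1) less.prems C(2)] C(3) by linarith
  qed
qed

text \<open>The counterpart for the part of a chain above \<open>F\<close>, obtained by descending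
  from \<open>Q\<close> through facets that contain \<open>F\<close>.\<close>

lemma face_rank_growth:
  assumes "Q face_of P" "F face_of P" "F \<noteq> {}" "F \<subseteq> Q"
  shows "face_rank (f F) + (aff_dim Q - aff_dim F) \<le> face_rank (f Q)"
  using assms(1,4)
proof (induction "nat (aff_dim Q)" arbitrary: Q rule: less_induct)
  case less
  show ?case
  proof (cases "F = Q")
    case False
    have "F face_of Q" using assms(2) less.prems face_of_subset face_of_imp_subset by metis
    then obtain C where C: "C facet_of Q" "F \<subseteq> C"
      using face_of_polyhedron_subset_facet[of Q F] False assms(3)
        face_of_polyhedron_polyhedron[OF polyhedron less.prems(1)] by blast
    have CP: "C face_of P" using C less.prems face_of_trans facet_of_imp_face_of by blast
    have dimC: "aff_dim C = aff_dim Q - 1" "C \<noteq> {}" using C by (auto simp: facet_of_def)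
    then have "C \<subset> Q" using facet_of_imp_subset[OF C(1)] by auto
    have "aff_dim C \<ge> 0" using dimC aff_dim_negative_iff[of C] by linarith
    then have "face_rank (f F) + (aff_dim C - aff_dim F) \<le> face_rank (f C)"
      using dimC C CP by (intro less.hyps) auto
    then show ?thesis using face_rank_f_strict_mono[OF CP less.prems(1) \<open>C \<subset> Q\<close>] dimC by linarith
  qed simp
qed

text \<open>The chain below \<open>F\<close> bounds the rank from below and the chain from
  \<open>F\<close> to \<open>P\<close> bounds it from above; since the prism has rank at most
  \<open>d\<close>, the bounds agree.\<close>

lemma face_rank_f:
  assumes "F face_of P" "F \<noteq> {}"
  shows "face_rank (f F) = aff_dim F"
proof -
  have "face_rank (f P) \<le> face_rank (coord_product \<Delta>)"
  proof (cases "f P = coord_product \<Delta>")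
    case False
    then show ?thesis
      using False face_rank_strict_mono[of "f P" "coord_product \<Delta>"] f_face_of[OF P_face]
        face_of_imp_subset[OF f_face_of[OF P_face]] face_of_refl[OF convex_prism] by (simp add: psubset_eq)
  qed simp
  also have "\<dots> \<le> int d" using face_rank_le aff_dim_prism by simp
  finally have "face_rank (f P) \<le> int d" .
  moreover have "face_rank (f F) + (aff_dim P - aff_dim F) \<le> face_rank (f P)"
    using assms face_of_imp_subset by (intro face_rank_growth P_face) auto
  ultimately show ?thesis using aff_dim_le_face_rank[OF assms(1)] aff_dim_P by linarith
qed

lemma f_nonempty:
  assumes "F face_of P" "F \<noteq> {}"
  shows "f F \<noteq> {}"
proof -
  have "aff_dim F \<ge> 0" using assms aff_dim_negative_iff[of F] by linarith
  then show ?thesis using face_rank_f[OF assms] by (auto simp: face_rank_def)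
qed

lemma box_rank_bx:
  assumes "F face_of P" "F \<noteq> {}"
  shows "int (box_rank (bx F)) = aff_dim F"
  using face_rank_f[OF assms] f_nonempty[OF assms] by (simp add: face_rank_def bx_def)

lemma box_bx:
  assumes "F face_of P" "F \<noteq> {}"
  shows "box (bx F)" "box_face (bx F) = f F"
  using face_box[OF f_face_of[OF assms(1)] f_nonempty[OF assms]] by (auto simp: bx_def)

lemma bx_mono: "\<lbrakk>F face_of P; G face_of P; F \<subseteq> G\<rbrakk> \<Longrightarrow> bx F \<le> bx G"
  using f_mono[of F G] by (auto simp: bx_def face_box_def le_fun_def)

lemma bx_inj: "\<lbrakk>F face_of P; G face_of P; F \<noteq> {}; G \<noteq> {}; bx F = bx G\<rbrakk> \<Longrightarrow> F = G"
  using box_bx f_inj by metis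

lemma P_nonempty: "P \<noteq> {}"
  using pointed by (auto simp: extreme_point_of_def)

lemma bx_le_U: "F face_of P \<Longrightarrow> F \<noteq> {} \<Longrightarrow> bx F \<le> U"
  using box_bx(1) by (auto simp: box_def le_fun_def)

text \<open>The converse of the inequality in \<open>box_rank_le_aff_dim\<close> is supplied by
  \<open>P\<close>, whose image already has rank \<open>d\<close>.\<close>

lemma box_rank_U: "box_rank U = d"
proof -
  have le: "box_rank U \<le> d"
    using box_rank_le_aff_dim[OF box_U] aff_dim_prism by (simp add: box_face_U)
  have "box_rank (bx P) = d" using box_rank_bx[OF P_face P_nonempty] aff_dim_P by simp
  then have "bx P = U"
    using box_rank_strict_mono[OF box_bx(1)[OF P_face P_nonempty] box_U bx_le_U[OF P_face P_nonempty]] le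
    by linarith
  then show ?thesis using \<open>box_rank (bx P) = d\<close> by simp
qed

subsection \<open>Vertices\<close>

definition sv :: "'a \<Rightarrow> 'b ^ 'm" where
  "sv v = (THE s. f {v} = {s})"

lemma vertex_face: "v \<in> vertices P \<longleftrightarrow> {v} face_of P"
  by (simp add: vertices_def face_of_singleton)

lemma sv:
  assumes "v \<in> vertices P"
  shows "f {v} = {sv v}" "bx {v} = (\<lambda>i. {sv v $ i})" "sv v \<in> coord_product U"
proof -
  have v: "{v} face_of P" using assms vertex_face by simp
  then have "box_rank (bx {v}) = 0" using box_rank_bx[of "{v}"] by simp
  then obtain s where s: "bx {v} = (\<lambda>i. {s $ i})" "s \<in> coord_product U"
    using box_rank_eq_0[OF box_bx(1)[OF v]] by auto
  then have fv: "f {v} = {s}" using box_bx(2)[OF v] by (simp add: box_face_singleton)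
  then have "sv v = s" by (simp add: sv_def)
  then show "f {v} = {sv v}" "bx {v} = (\<lambda>i. {sv v $ i})" "sv v \<in> coord_product U"
    using fv s by auto
qed

lemma sv_inj:
  assumes "v \<in> vertices P" "w \<in> vertices P" "sv v = sv w"
  shows "v = w"
  using f_inj[of "{v}" "{w}"] assms sv(1) by (simp add: vertex_face)

lemma sv_mem_bx:
  assumes "v \<in> vertices P" "F face_of P" "v \<in> F"
  shows "sv v \<in> coord_product (bx F)"
  using bx_mono[of "{v}" F] assms sv(2)[OF assms(1)]
  by (auto simp: vertex_face le_fun_def mem_coord_product)

lemma b_set_eq: "b_set P (coord_product \<Delta>) f = sv ` vertices P"
proof
  show "b_set P (coord_product \<Delta>) f \<subseteq> sv ` vertices P"
    using sv(1) by (auto simp: b_set_def)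
  show "sv ` vertices P \<subseteq> b_set P (coord_product \<Delta>) f"
  proof
    fix s assume "s \<in> sv ` vertices P"
    then obtain v where v: "v \<in> vertices P" "s = sv v" by blast
    then have "{s} face_of coord_product \<Delta>"
      using f_face_of[of "{v}"] sv(1)[OF v(1)] by (simp add: vertex_face)
    then have "s \<in> vertices (coord_product \<Delta>)" by (simp add: vertices_def face_of_singleton)
    then show "s \<in> b_set P (coord_product \<Delta>) f" using v sv(1) by (auto simp: b_set_def)
  qed
qed

lemma face_has_vertex:
  assumes "F face_of P" "F \<noteq> {}"
  obtains v where "v \<in> vertices P" "v \<in> F"
  using pointed_face_has_vertex[OF polyhedron pointed assms] by (auto simp: vertices_def)

subsection \<open>The facets at a vertex\<close>

text \<open>The box of the facet of the prism opposite to a vertex of one factor. If that factor is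
  a single point, one side is empty and this is not a box; then \<open>Fc j\<close> is
  empty.\<close>

definition del :: "'m \<times> 'b \<Rightarrow> 'm \<Rightarrow> 'b set" where
  "del j = U(fst j := U (fst j) - {snd j})"

text \<open>The facet of \<open>P\<close> that is sent to the facet of the prism without the vertex \<open>u\<close> of
  \<open>\<Delta> i\<close>, for \<open>j = (i, u)\<close>; the empty set if there is no such facet.\<close>

definition Fc :: "'m \<times> 'b \<Rightarrow> 'a set" where
  "Fc j = \<Union>{F. F face_of P \<and> F \<noteq> {} \<and> bx F = del j}"

lemma mem_del: "w \<in> del j k \<longleftrightarrow> w \<in> U k \<and> (k, w) \<noteq> j"
  by (cases j) (auto simp: del_def)

text \<open>By injectivity the union that defines \<open>Fc\<close> has at most one member.\<close>

lemma Fc_eq: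
  assumes "F face_of P" "F \<noteq> {}" "bx F = del j"
  shows "Fc j = F"
  using assms bx_inj[OF assms(1) _ assms(2)] unfolding Fc_def by fastforce

lemma Fc_cases:
  obtains "Fc j = {}" | "Fc j face_of P" "Fc j \<noteq> {}" "bx (Fc j) = del j"
proof (cases "\<exists>F. F face_of P \<and> F \<noteq> {} \<and> bx F = del j")
  case True
  then show ?thesis using Fc_eq that(2) by metis
next
  case False
  then have "Fc j = {}" unfolding Fc_def by blast
  then show ?thesis by (rule that(1))
qed

lemma Fc_face: "Fc j face_of P"
  by (cases rule: Fc_cases[of j]) auto

abbreviation N :: "'a \<Rightarrow> ('m \<times> 'b) set" where
  "N v \<equiv> neighbours (sv v) U"

lemma card_N: "v \<in> vertices P \<Longrightarrow> card (N v) = d"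
  using card_neighbours[of U "sv v"] U(1) sv(3) box_rank_U by simp

lemma finite_N: "finite (N v)"
  using U(1) by (intro finite_neighbours) auto

text \<open>The image of \<open>c\<close> has rank \<open>d - 1\<close>, so among the
  \<open>d\<close> neighbours of \<open>sv v\<close> its box lacks exactly one.\<close>

lemma facet_bx:
  assumes v: "v \<in> vertices P" and c: "c facet_of P" "v \<in> c"
  obtains j where "j \<in> N v" "bx c = del j"
proof -
  have cP: "c face_of P" "c \<noteq> {}" using c by (auto simp: facet_of_def)
  note bc = box_bx(1)[OF cP]
  have s: "sv v \<in> coord_product (bx c)" using sv_mem_bx v cP c by blast
  have "int (box_rank (bx c)) = int d - 1"
    using box_rank_bx[OF cP] c aff_dim_P by (simp add: facet_of_def)
  then have rank: "Suc (box_rank (bx c)) = d" by linarith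
  have sub: "neighbours (sv v) (bx c) \<subseteq> N v"
    using bx_le_U[OF cP] by (auto simp: neighbours_def le_fun_def)
  have "card (neighbours (sv v) (bx c)) = box_rank (bx c)"
    using s bc box_finite by (intro card_neighbours) auto
  then have "card (N v - neighbours (sv v) (bx c)) = 1"
    using card_Diff_subset[OF finite_subset[OF sub finite_N] sub] card_N[OF v] rank by linarith
  then obtain j where j: "N v - neighbours (sv v) (bx c) = {j}" by (auto simp: card_1_singleton_iff)
  have "w \<in> bx c k \<longleftrightarrow> w \<in> del j k" for k w
  proof (cases "w = sv v $ k")
    case True
    have "j \<in> N v" using j by blast
    then have "(k, w) \<noteq> j" using True by (cases j) (auto simp: mem_neighbours)
    then show ?thesis using True s sv(3)[OF v] by (auto simp: mem_del mem_coord_product)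
  next
    case False
    then have "w \<in> bx c k \<longleftrightarrow> (k, w) \<in> neighbours (sv v) (bx c)" by (simp add: mem_neighbours)
    also have "\<dots> \<longleftrightarrow> (k, w) \<in> N v \<and> (k, w) \<noteq> j" using j sub by blast
    also have "\<dots> \<longleftrightarrow> w \<in> del j k" using False by (auto simp: mem_neighbours mem_del)
    finally show ?thesis .
  qed
  then have "bx c = del j" by auto
  then show ?thesis using that j by blast
qed

text \<open>Local coordinates at \<open>v\<close>, indexed by the neighbours of \<open>sv v\<close>:
  \<open>a j\<close> is an outer normal of \<open>Fc j\<close>, and \<open>e j\<close> is the
  direction of the edge that leaves it. The indexing is a bijection because at least
  \<open>d\<close> facets at \<open>v\<close> are injected into \<open>d\<close> neighbours.\<close>

lemma vertex_frame:
  assumes v: "v \<in> vertices P"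
  obtains a e where
    "\<And>j. j \<in> N v \<Longrightarrow> v \<in> Fc j \<and> bx (Fc j) = del j"
    "\<And>c. c facet_of P \<Longrightarrow> v \<in> c \<Longrightarrow> \<exists>j\<in>N v. c = Fc j"
    "\<And>j x. j \<in> N v \<Longrightarrow> x \<in> P \<Longrightarrow> a j \<bullet> (x - v) \<le> (0::real)"
    "\<And>j x. j \<in> N v \<Longrightarrow> x \<in> P \<Longrightarrow> x \<in> Fc j \<longleftrightarrow> a j \<bullet> (x - v) = 0"
    "\<And>j k. j \<in> N v \<Longrightarrow> k \<in> N v \<Longrightarrow> a k \<bullet> e j = (if k = j then - 1 else 0)"
    "\<And>x. x \<in> P \<Longrightarrow> x - v = (\<Sum>j\<in>N v. - (a j \<bullet> (x - v)) *\<^sub>R e j)"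
    "\<And>j. j \<in> N v \<Longrightarrow> \<exists>\<epsilon>>0. v + \<epsilon> *\<^sub>R e j \<in> P"
proof -
  obtain \<alpha> \<beta> where
    ab: "P = affine hull P \<inter> {x. \<forall>c. c facet_of P \<longrightarrow> \<alpha> c \<bullet> x \<le> (\<beta> c :: real)}"
    "\<And>c. c facet_of P \<Longrightarrow> c = P \<inter> {x. \<alpha> c \<bullet> x = \<beta> c}"
    by (rule polyhedron_facet_description[OF polyhedron P_nonempty]) (rule that)
  interpret pv: polyhedron_vertex P d \<alpha> \<beta> v
    using polyhedron aff_dim_P ab v by unfold_locales (auto simp: vertices_def)
  have "\<exists>j. j \<in> N v \<and> bx c = del j" if "c \<in> pv.facets" for c
    using facet_bx[OF v] that unfolding pv.facets_def by blast
  then obtain k where k: "\<And>c. c \<in> pv.facets \<Longrightarrow> k c \<in> N v \<and> bx c = del (k c)" by metis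
  have face: "c face_of P \<and> c \<noteq> {} \<and> v \<in> c" if "c \<in> pv.facets" for c
    using that by (auto simp: pv.facets_def facet_of_def)
  have Fck: "Fc (k c) = c" if "c \<in> pv.facets" for c
    using k face that by (intro Fc_eq) auto
  have inj: "inj_on k pv.facets" by (rule inj_on_inverseI[of _ Fc]) (rule Fck)
  have sub: "k ` pv.facets \<subseteq> N v" using k by blast
  have "card (k ` pv.facets) = card pv.facets" using inj by (rule card_image)
  moreover have "card (k ` pv.facets) \<le> card (N v)" using sub finite_N by (intro card_mono) auto
  ultimately have card: "card pv.facets = d" and "card (k ` pv.facets) = card (N v)"
    using pv.card_facets_ge card_N[OF v] by auto
  then have img: "k ` pv.facets = N v" using sub finite_N by (intro card_subset_eq) auto
  obtain e where e: "\<And>c. c \<in> pv.facets \<Longrightarrow> e c \<in> pv.V"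
    "\<And>c c'. c \<in> pv.facets \<Longrightarrow> c' \<in> pv.facets \<Longrightarrow> \<alpha> c' \<bullet> e c = (if c' = c then - 1 else 0)"
    "\<And>w. w \<in> pv.V \<Longrightarrow> w = (\<Sum>c\<in>pv.facets. - (\<alpha> c \<bullet> w) *\<^sub>R e c)"
    by (rule pv.dual_basis[OF card]) (rule that)
  have FcN: "Fc j \<in> pv.facets \<and> k (Fc j) = j" if "j \<in> N v" for j
  proof -
    have "j \<in> k ` pv.facets" using that by (simp only: img)
    then obtain c where c: "c \<in> pv.facets" "j = k c" by blast
    then show ?thesis using Fck[OF c(1)] by simp
  qed
  show ?thesis
  proof (rule that[of "\<lambda>j. \<alpha> (Fc j)" "\<lambda>j. e (Fc j)"])
    fix j assume j: "j \<in> N v"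
    show "v \<in> Fc j \<and> bx (Fc j) = del j" using FcN[OF j] face[of "Fc j"] k[of "Fc j"] by simp
    show "\<exists>\<epsilon>>0. v + \<epsilon> *\<^sub>R e (Fc j) \<in> P"
    proof -
      have "\<alpha> c \<bullet> e (Fc j) \<le> 0" if "c \<in> pv.facets" for c using e(2)[OF conjunct1[OF FcN[OF j]] that] by simp
      then show ?thesis using pv.local_cone[OF e(1)[OF conjunct1[OF FcN[OF j]]]] by blast
    qed
    fix x assume x: "x \<in> P"
    show "\<alpha> (Fc j) \<bullet> (x - v) \<le> 0" using pv.facets_nonpos[OF conjunct1[OF FcN[OF j]] x] .
    show "x \<in> Fc j \<longleftrightarrow> \<alpha> (Fc j) \<bullet> (x - v) = 0" using pv.mem_facet_iff[OF conjunct1[OF FcN[OF j]] x] .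
  next
    fix c assume "c facet_of P" "v \<in> c"
    then have "c \<in> pv.facets" by (simp add: pv.facets_def)
    then have "k c \<in> N v" "Fc (k c) = c" using k Fck by blast+
    then show "\<exists>j\<in>N v. c = Fc j" by metis
  next
    fix j i assume ji: "j \<in> N v" "i \<in> N v"
    have "Fc i = Fc j \<longleftrightarrow> i = j" using FcN[OF ji(1)] FcN[OF ji(2)] by (metis (no_types))
    then show "\<alpha> (Fc i) \<bullet> e (Fc j) = (if i = j then - 1 else 0)"
      using e(2)[of "Fc j" "Fc i"] FcN[OF ji(1)] FcN[OF ji(2)] by (simp only:)
  next
    fix x assume x: "x \<in> P"
    have "x - v = (\<Sum>c\<in>pv.facets. - (\<alpha> c \<bullet> (x - v)) *\<^sub>R e c)"
      by (rule e(3)[OF pv.diff_in_V[OF x]])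
    also have "\<dots> = (\<Sum>c\<in>pv.facets. - (\<alpha> (Fc (k c)) \<bullet> (x - v)) *\<^sub>R e (Fc (k c)))"
      by (rule sum.cong[OF refl]) (simp only: Fck)
    also have "\<dots> = (\<Sum>j\<in>k ` pv.facets. - (\<alpha> (Fc j) \<bullet> (x - v)) *\<^sub>R e (Fc j))"
      using sum.reindex[OF inj, of "\<lambda>j. - (\<alpha> (Fc j) \<bullet> (x - v)) *\<^sub>R e (Fc j)"]
      by (simp only: o_def)
    also have "\<dots> = (\<Sum>j\<in>N v. - (\<alpha> (Fc j) \<bullet> (x - v)) *\<^sub>R e (Fc j))"
      by (simp only: img)
    finally show "x - v = (\<Sum>j\<in>N v. - (\<alpha> (Fc j) \<bullet> (x - v)) *\<^sub>R e (Fc j))" .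
  qed
qed

text \<open>A proper face is the intersection of the facets that contain it, and these pass through
  \<open>v\<close>, so all are of the form \<open>Fc j\<close>.\<close>

lemma mem_face_iff:
  assumes v: "v \<in> vertices P" and F: "F face_of P" "v \<in> F" and x: "x \<in> P"
  shows "x \<in> F \<longleftrightarrow> (\<forall>j\<in>N v. F \<subseteq> Fc j \<longrightarrow> x \<in> Fc j)"
proof
  assume R: "\<forall>j\<in>N v. F \<subseteq> Fc j \<longrightarrow> x \<in> Fc j"
  show "x \<in> F"
  proof (cases "F = P")
    case False
    then have "F = \<Inter>{c. c facet_of P \<and> F \<subseteq> c}"
      using F by (intro face_of_polyhedron[OF polyhedron]) auto
    moreover have "x \<in> c" if c: "c facet_of P" "F \<subseteq> c" for c
    proof -
      have "v \<in> c" using c F by blast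
      then obtain j where "j \<in> N v" "c = Fc j" using vertex_frame[OF v] c(1) by (metis (full_types))
      then show ?thesis using R c by blast
    qed
    ultimately show ?thesis by blast
  qed (use x in simp)
qed auto

text \<open>Monotonicity of \<open>f\<close> gives only one inclusion between the boxes. Equality
  follows because the dimension of the intersection is at least the rank of the larger box.\<close>

lemma face_with_box:
  assumes v: "v \<in> vertices P" and D: "D \<subseteq> N v"
  shows "bx (P \<inter> (\<Inter>j\<in>D. Fc j)) = (\<lambda>i. {u \<in> U i. (i, u) \<notin> D})"
    and "P \<inter> (\<Inter>j\<in>D. Fc j) face_of P" "v \<in> P \<inter> (\<Inter>j\<in>D. Fc j)"
proof -
  obtain a e where fr: "\<And>j. j \<in> N v \<Longrightarrow> v \<in> Fc j \<and> bx (Fc j) = del j"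
    "\<And>j x. j \<in> N v \<Longrightarrow> x \<in> P \<Longrightarrow> x \<in> Fc j \<longleftrightarrow> a j \<bullet> (x - v) = (0::real)"
    "\<And>j k. j \<in> N v \<Longrightarrow> k \<in> N v \<Longrightarrow> a k \<bullet> e j = (if k = j then - 1 else 0)"
    "\<And>j. j \<in> N v \<Longrightarrow> \<exists>\<epsilon>>0. v + \<epsilon> *\<^sub>R e j \<in> P"
    by (rule vertex_frame[OF v]) (rule that; assumption)
  have vP: "v \<in> P" using v by (simp add: vertices_def extreme_point_of_def)
  define G where "G D = P \<inter> (\<Inter>j\<in>D. Fc j)" for D
  have G_face: "G D face_of P" if "D \<subseteq> N v" for D
  proof -
    have "G D = \<Inter>(insert P (Fc ` D))" by (auto simp: G_def)
    moreover have "\<Inter>(insert P (Fc ` D)) face_of P"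
      using P_face Fc_face by (intro face_of_Inter) auto
    ultimately show ?thesis by simp
  qed
  have vG: "v \<in> G D" if "D \<subseteq> N v" for D using that fr(1) vP by (auto simp: G_def)
  have dim: "int (card (N v - D)) \<le> aff_dim (G D)" if "D \<subseteq> N v" for D
    using that
  proof (induction "card (N v - D)" arbitrary: D)
    case 0
    then show ?case using vG[of D] aff_dim_negative_iff[of "G D"] by (metis empty_iff linorder_not_less of_nat_0)
  next
    case (Suc n)
    then have "N v - D \<noteq> {}" by auto
    then obtain j where j: "j \<in> N v" "j \<notin> D" by blast
    \<comment> \<open>A point on the edge along \<open>e j\<close> lies in every \<open>Fc k\<close>
      with \<open>k\<close> in \<open>D\<close> but not in \<open>Fc j\<close>, so intersecting with
      \<open>Fc j\<close> lowers the dimension.\<close>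
    obtain \<epsilon> where \<epsilon>: "\<epsilon> > 0" "v + \<epsilon> *\<^sub>R e j \<in> P" using fr(4)[OF j(1)] by blast
    have "v + \<epsilon> *\<^sub>R e j \<in> G D"
      unfolding G_def using \<epsilon>(2) j Suc.prems fr(2)[OF _ \<epsilon>(2)] fr(3)[OF j(1)] by auto
    moreover have "v + \<epsilon> *\<^sub>R e j \<notin> Fc j"
      using fr(2)[OF j(1) \<epsilon>(2)] fr(3)[OF j(1) j(1)] \<epsilon>(1) by simp
    ultimately have ne: "G (insert j D) \<noteq> G D" by (auto simp: G_def)
    have sub: "insert j D \<subseteq> N v" using j Suc.prems by blast
    have "N v - D = insert j (N v - insert j D)" using j by blast
    then have card: "card (N v - D) = Suc (card (N v - insert j D))"
      using finite_N by (metis Diff_iff card_insert_disjoint finite_Diff insertI1)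
    then have "int (card (N v - insert j D)) \<le> aff_dim (G (insert j D))"
      using Suc.hyps(2) by (intro Suc.hyps(1)[OF _ sub]) simp
    moreover have "G (insert j D) face_of G D"
      using face_of_subset[OF G_face[OF sub]] face_of_imp_subset[OF G_face[OF Suc.prems]]
      by (auto simp: G_def)
    then have "aff_dim (G (insert j D)) < aff_dim (G D)"
      using ne face_of_imp_convex[OF G_face[OF Suc.prems]] by (intro face_of_aff_dim_lt)
    ultimately show ?case using card by linarith
  qed
  show face: "P \<inter> (\<Inter>j\<in>D. Fc j) face_of P" and vD: "v \<in> P \<inter> (\<Inter>j\<in>D. Fc j)"
    using G_face vG D unfolding G_def by blast+
  let ?B = "\<lambda>i. {u \<in> U i. (i, u) \<notin> D}"
  have ne: "G D \<noteq> {}" using vG[OF D] by blast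
  have le: "bx (G D) \<le> ?B"
  proof (rule le_funI, rule subsetI)
    fix i u assume u: "u \<in> bx (G D) i"
    have "u \<in> U i" using u bx_le_U[OF G_face[OF D] ne] by (auto simp: le_fun_def)
    moreover have "(i, u) \<notin> D"
    proof
      assume j: "(i, u) \<in> D"
      then have "G D \<subseteq> Fc (i, u)" unfolding G_def by blast
      then have "bx (G D) \<le> del (i, u)" using bx_mono[OF G_face[OF D] Fc_face] fr(1) j D by (metis subsetD)
      then have "u \<in> del (i, u) i" using u by (metis le_funD subsetD)
      then show False by (simp add: mem_del)
    qed
    ultimately show "u \<in> ?B i" by blast
  qed
  have sB: "sv v \<in> coord_product ?B"
    using le sv_mem_bx[OF v G_face[OF D] vG[OF D]] by (auto simp: le_fun_def mem_coord_product)
  then have bB: "box ?B" by (auto simp: box_def mem_coord_product)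
  have "neighbours (sv v) ?B = N v - D" by (auto simp: neighbours_def)
  then have "box_rank ?B = card (N v - D)"
    using card_neighbours[OF box_finite[OF bB] sB] by simp
  then have "int (box_rank ?B) \<le> int (box_rank (bx (G D)))"
    using dim[OF D] box_rank_bx[OF G_face[OF D] ne] by simp
  then have "bx (G D) = ?B"
    using box_rank_strict_mono[OF box_bx(1)[OF G_face[OF D] ne] bB le] by linarith
  then show "bx (P \<inter> (\<Inter>j\<in>D. Fc j)) = ?B" by (simp add: G_def)
qed

lemma ex_face_with_box:
  assumes v: "v \<in> vertices P" and B: "box B" "sv v \<in> coord_product B"
  obtains F where "F face_of P" "v \<in> F" "bx F = B"
proof -
  let ?D = "N v - neighbours (sv v) B"
  have "(\<lambda>i. {u \<in> U i. (i, u) \<notin> ?D}) = B"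
    using B by (auto simp: mem_neighbours box_def mem_coord_product fun_eq_iff)
  then show ?thesis using face_with_box[OF v, of ?D] that by auto
qed

text \<open>The face at \<open>w\<close> with the same box as \<open>F\<close> exists by
  \<open>ex_face_with_box\<close> and is \<open>F\<close> by injectivity.\<close>

lemma vertex_mem_face:
  assumes w: "w \<in> vertices P" and F: "F face_of P" "F \<noteq> {}" and s: "sv w \<in> coord_product (bx F)"
  shows "w \<in> F"
proof -
  obtain G where "G face_of P" "w \<in> G" "bx G = bx F"
    using ex_face_with_box[OF w box_bx(1)[OF F] s] by blast
  then show ?thesis using bx_inj[of G F] F by auto
qed

text \<open>The dictionary between sides of boxes and facets. For a neighbour \<open>(i, u)\<close>
  of the image of a vertex of \<open>F\<close>, it is read off from \<open>F\<close> as the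
  intersection of the facets \<open>Fc j\<close> that contain it.\<close>

lemma mem_bx_iff:
  assumes F: "F face_of P" "F \<noteq> {}" and u: "u \<in> U i"
  shows "u \<in> bx F i \<longleftrightarrow> \<not> F \<subseteq> Fc (i, u)"
proof -
  obtain v where v: "v \<in> vertices P" "v \<in> F" using face_has_vertex[OF F] by blast
  show ?thesis
  proof (cases "u = sv v $ i")
    case True
    have "u \<in> bx F i" using sv_mem_bx[OF v(1) F(1) v(2)] True by (auto simp: mem_coord_product)
    moreover have "\<not> F \<subseteq> Fc (i, u)"
    proof
      assume sub: "F \<subseteq> Fc (i, u)"
      then have "Fc (i, u) \<noteq> {}" using F by auto
      then have "bx (Fc (i, u)) = del (i, u)" using Fc_cases[of "(i, u)"] by blast
      then have "u \<in> del (i, u) i"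
        using bx_mono[OF F(1) Fc_face sub] \<open>u \<in> bx F i\<close> by (auto simp: le_fun_def)
      then show False by (simp add: mem_del)
    qed
    ultimately show ?thesis by blast
  next
    case False
    define D where "D = {j \<in> N v. F \<subseteq> Fc j}"
    have D: "D \<subseteq> N v" by (auto simp: D_def)
    have FP: "F \<subseteq> P" using F face_of_imp_subset by blast
    have "F = P \<inter> (\<Inter>j\<in>D. Fc j)"
    proof
      show "F \<subseteq> P \<inter> (\<Inter>j\<in>D. Fc j)" using FP by (auto simp: D_def)
      show "P \<inter> (\<Inter>j\<in>D. Fc j) \<subseteq> F"
      proof
        fix x assume x: "x \<in> P \<inter> (\<Inter>j\<in>D. Fc j)"
        then have "\<forall>j\<in>N v. F \<subseteq> Fc j \<longrightarrow> x \<in> Fc j" by (auto simp: D_def)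
        then show "x \<in> F" using mem_face_iff[OF v(1) F(1) v(2)] x by blast
      qed
    qed
    then have "bx F = (\<lambda>i. {u \<in> U i. (i, u) \<notin> D})" using face_with_box(1)[OF v(1) D] by simp
    moreover have "(i, u) \<in> N v" using False u by (simp add: mem_neighbours)
    ultimately show ?thesis using u by (simp add: D_def)
  qed
qed

text \<open>\<open>f\<close> is only assumed to preserve inclusion; here inclusion is reflected. A
  vertex of \<open>F\<close> lies in \<open>G\<close> by its coordinates, and then every facet that
  contains \<open>G\<close> contains \<open>F\<close>.\<close>

lemma bx_le_imp_subset:
  assumes F: "F face_of P" "F \<noteq> {}" and G: "G face_of P" "G \<noteq> {}" and le: "bx F \<le> bx G"
  shows "F \<subseteq> G"
proof
  fix x assume x: "x \<in> F"
  obtain v where v: "v \<in> vertices P" "v \<in> F" using face_has_vertex[OF F] by blast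
  have "sv v \<in> coord_product (bx G)"
    using sv_mem_bx[OF v(1) F(1) v(2)] le by (auto simp: le_fun_def mem_coord_product)
  then have vG: "v \<in> G" using vertex_mem_face[OF v(1) G] by blast
  have xP: "x \<in> P" using x F face_of_imp_subset by blast
  have "x \<in> Fc j" if j: "j \<in> N v" "G \<subseteq> Fc j" for j
  proof -
    obtain i u where iu: "j = (i, u)" by (cases j)
    then have u: "u \<in> U i" using j by (auto simp: mem_neighbours)
    have "u \<notin> bx G i" using mem_bx_iff[OF G u] j iu by blast
    then have "u \<notin> bx F i" using le by (auto simp: le_fun_def)
    then show ?thesis using mem_bx_iff[OF F u] x iu by blast
  qed
  then show "x \<in> G" using mem_face_iff[OF v(1) G(1) vG xP] by blast
qed

end

section \<open>Bounded faces and corner peelings\<close>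

context prism_like
begin

text \<open>The box with the single nontrivial side \<open>{sv v $ i, u}\<close> belongs to an edge
  \<open>E\<close> at \<open>v\<close>. As \<open>F\<close> is bounded, \<open>E\<close> is a
  segment, and its other end is the vertex sought.\<close>

lemma bounded_face_neighbour:
  assumes F: "F face_of P" "bounded_face P F" and v: "v \<in> vertices P" "v \<in> F"
    and u: "u \<in> bx F i" "u \<noteq> sv v $ i"
  obtains w where "w \<in> vertices P" "w \<in> F" "sv w = vec_update (sv v) i u"
proof -
  obtain a e where fr: "\<And>j x. j \<in> N v \<Longrightarrow> x \<in> P \<Longrightarrow> a j \<bullet> (x - v) \<le> (0::real)"
    "\<And>j x. j \<in> N v \<Longrightarrow> x \<in> P \<Longrightarrow> x \<in> Fc j \<longleftrightarrow> a j \<bullet> (x - v) = 0"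
    "\<And>j k. j \<in> N v \<Longrightarrow> k \<in> N v \<Longrightarrow> a k \<bullet> e j = (if k = j then - 1 else 0)"
    "\<And>x. x \<in> P \<Longrightarrow> x - v = (\<Sum>j\<in>N v. - (a j \<bullet> (x - v)) *\<^sub>R e j)"
    by (rule vertex_frame[OF v(1)]) (rule that; assumption)
  have F0: "F \<noteq> {}" using v by auto
  have uU: "u \<in> U i" using u bx_le_U[OF F(1) F0] by (auto simp: le_fun_def)
  let ?j = "(i, u)"
  have j: "?j \<in> N v" using u uU by (simp add: mem_neighbours)
  let ?B = "\<lambda>k. if k = i then {sv v $ i, u} else {sv v $ k}"
  have sF: "sv v \<in> coord_product (bx F)" using sv_mem_bx[OF v(1) F(1) v(2)] .
  have B: "box ?B" "sv v \<in> coord_product ?B" "?B \<le> bx F"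
    using sv(3)[OF v(1)] uU u sF by (auto simp: box_def mem_coord_product le_fun_def)
  obtain E where E: "E face_of P" "v \<in> E" "bx E = ?B"
    using ex_face_with_box[OF v(1) B(1,2)] by blast
  have E0: "E \<noteq> {}" using E by auto
  have EF: "E \<subseteq> F" using bx_le_imp_subset[OF E(1) E0 F(1) F0] E(3) B(3) by simp
  have EP: "E \<subseteq> P" using E face_of_imp_subset by blast
  have "neighbours (sv v) ?B = {?j}" using u(2) by (auto simp: neighbours_def split: if_splits)
  then have "box_rank ?B = 1" using card_neighbours[OF box_finite[OF B(1)] B(2)] by simp
  then have dimE: "aff_dim E = 1" using box_rank_bx[OF E(1) E0] E(3) by simp
  have EFc: "E \<subseteq> Fc k \<longleftrightarrow> k \<noteq> ?j" if k: "k \<in> N v" for k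
  proof -
    obtain l t where lt: "k = (l, t)" by (cases k)
    then have "t \<in> U l" "t \<noteq> sv v $ l" using k by (auto simp: mem_neighbours)
    then show ?thesis using mem_bx_iff[OF E(1) E0, of t l] E(3) lt by (auto split: if_splits)
  qed
  \<comment> \<open>All facets \<open>Fc k\<close> at \<open>v\<close> with
    \<open>k \<noteq> ?j\<close> contain \<open>E\<close>, so the expansion of \<open>x - v\<close>
    keeps a single term.\<close>
  have ray: "\<exists>c\<ge>0. x = v + c *\<^sub>R e ?j" if x: "x \<in> E" for x
  proof -
    have xP: "x \<in> P" using x EP by blast
    have "x - v = (\<Sum>k\<in>N v. - (a k \<bullet> (x - v)) *\<^sub>R e k)" by (rule fr(4)[OF xP])
    also have "\<dots> = (\<Sum>k\<in>N v. if k = ?j then - (a k \<bullet> (x - v)) *\<^sub>R e k else 0)"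
    proof (intro sum.cong refl)
      fix k assume k: "k \<in> N v"
      have "a k \<bullet> (x - v) = 0" if "k \<noteq> ?j" using fr(2)[OF k xP] EFc[OF k] x that by blast
      then show "- (a k \<bullet> (x - v)) *\<^sub>R e k = (if k = ?j then - (a k \<bullet> (x - v)) *\<^sub>R e k else 0)" by simp
    qed
    also have "\<dots> = - (a ?j \<bullet> (x - v)) *\<^sub>R e ?j" using j finite_N by simp
    finally have "x = v + (- (a ?j \<bullet> (x - v))) *\<^sub>R e ?j" by (simp add: algebra_simps)
    moreover have "- (a ?j \<bullet> (x - v)) \<ge> 0" using fr(1)[OF j xP] by simp
    ultimately show ?thesis by blast
  qed
  have inE: "v + c *\<^sub>R e ?j \<in> E" if "v + c *\<^sub>R e ?j \<in> P" for c
  proof -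
    have "v + c *\<^sub>R e ?j \<in> Fc k" if k: "k \<in> N v" "E \<subseteq> Fc k" for k
      using fr(2)[OF k(1) \<open>v + c *\<^sub>R e ?j \<in> P\<close>] fr(3)[OF j k(1)] k EFc by simp
    then show ?thesis using mem_face_iff[OF v(1) E(1,2) that] by blast
  qed
  have ej: "e ?j \<noteq> 0" using fr(3)[OF j j] by auto
  \<comment> \<open>The ray leaves \<open>P\<close> somewhere: otherwise \<open>e ?j\<close> would
    be a recession direction leading from \<open>v\<close> to a point of \<open>F\<close>.\<close>
  obtain T where T: "T \<ge> 0" "v + T *\<^sub>R e ?j \<notin> P"
  proof -
    have "\<exists>T\<ge>0. v + T *\<^sub>R e ?j \<notin> P"
    proof (rule ccontr)
      assume "\<not> ?thesis"
      then have all: "\<And>t. t \<ge> 0 \<Longrightarrow> v + t *\<^sub>R e ?j \<in> P" by blast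
      have "e ?j \<in> recession_directions P"
        by (rule ray_imp_recession_direction[OF polyhedron ej all])
      moreover have "v + e ?j \<in> F" using inE[of 1] all[of 1] EF by auto
      ultimately show False using F(2) v(2) unfolding bounded_face_def by blast
    qed
    then show ?thesis using that by blast
  qed
  have vP: "v \<in> P" using E EP by blast
  have "E \<subseteq> closed_segment v (v + T *\<^sub>R e ?j)"
  proof
    fix x assume x: "x \<in> E"
    then obtain c where c: "c \<ge> 0" "x = v + c *\<^sub>R e ?j" using ray by blast
    have "c < T"
    proof (rule ccontr)
      assume "\<not> c < T"
      then have cT: "T \<le> c" by simp
      then have c0: "c > 0" using T c(1) vP by (cases "c = 0") auto
      have "(1 - T / c) *\<^sub>R v + (T / c) *\<^sub>R x \<in> P"
        using convex_P vP x EP cT c0 T(1) by (intro convexD_alt) auto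
      moreover have "(1 - T / c) *\<^sub>R v + (T / c) *\<^sub>R x = v + T *\<^sub>R e ?j"
        using c0 by (simp add: c(2) algebra_simps)
      ultimately show False using T(2) by simp
    qed
    then have "x = (1 - c / T) *\<^sub>R v + (c / T) *\<^sub>R (v + T *\<^sub>R e ?j)" "0 \<le> c / T" "c / T \<le> 1"
      using c by (auto simp: algebra_simps)
    then show "x \<in> closed_segment v (v + T *\<^sub>R e ?j)" unfolding in_segment by blast
  qed
  then have "bounded E" using bounded_closed_segment bounded_subset by blast
  moreover have "closed E"
    using face_of_polyhedron_polyhedron[OF polyhedron E(1)] polyhedron_imp_closed by blast
  ultimately have "compact E" by (simp add: compact_eq_bounded_closed)
  moreover have "convex E" using E(1) face_of_imp_convex by blast
  ultimately have KM: "E = convex hull {x. x extreme_point_of E}" by (rule Krein_Milman_Minkowski)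
  \<comment> \<open>A set of dimension 1 is not the hull of \<open>v\<close> alone, so
    \<open>E\<close> has another extreme point.\<close>
  obtain w where w: "w extreme_point_of E" "w \<noteq> v"
  proof -
    have "\<exists>w. w extreme_point_of E \<and> w \<noteq> v"
    proof (rule ccontr)
      assume "\<not> ?thesis"
      then have "{x. x extreme_point_of E} \<subseteq> {v}" by blast
      then have "convex hull {x. x extreme_point_of E} \<subseteq> convex hull {v}" by (rule hull_mono)
      then have "E \<subseteq> {v}" using KM by simp
      then have "aff_dim E \<le> aff_dim {v}" by (rule aff_dim_subset)
      then show False using dimE by simp
    qed
    then show ?thesis using that by blast
  qed
  have wE: "w \<in> E" using w by (simp add: extreme_point_of_def)
  have "{w} face_of P" using w(1) E(1) face_of_trans by (metis face_of_singleton)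
  then have wV: "w \<in> vertices P" by (simp add: vertex_face)
  have sw: "sv w $ k \<in> ?B k" for k
    using sv_mem_bx[OF wV E(1) wE] E(3) by (auto simp: mem_coord_product)
  have "sv w \<noteq> sv v" using sv_inj[OF wV v(1)] w(2) by blast
  moreover have "sv w = sv v" if "sv w $ i = sv v $ i"
    unfolding vec_eq_iff
  proof
    fix k show "sv w $ k = sv v $ k" using sw[of k] that by (cases "k = i") auto
  qed
  ultimately have "sv w $ i = u" using sw[of i] by auto
  then have "sv w $ k = vec_update (sv v) i u $ k" for k
    using sw[of k] by (cases "k = i") (auto simp: vec_update_nth)
  then have "sv w = vec_update (sv v) i u" by (simp add: vec_eq_iff)
  then show ?thesis using that wV wE EF by blast
qed

text \<open>From any vertex of \<open>F\<close>, the coordinates are corrected one at a time by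
  moving to a neighbour inside \<open>F\<close>.\<close>

lemma bounded_face_full:
  assumes F: "F face_of P" "F \<noteq> {}" "bounded_face P F" and z: "z \<in> coord_product (bx F)"
  obtains w where "w \<in> vertices P" "w \<in> F" "sv w = z"
proof -
  have "\<exists>w. w \<in> vertices P \<and> w \<in> F \<and> (\<forall>i\<in>I. sv w $ i = z $ i)" if "finite I" for I
    using that
  proof induction
    case empty
    obtain v where "v \<in> vertices P" "v \<in> F" using face_has_vertex[OF F(1,2)] by blast
    then show ?case by blast
  next
    case (insert i I)
    then obtain w where w: "w \<in> vertices P" "w \<in> F" "\<forall>i\<in>I. sv w $ i = z $ i" by blast
    show ?case
    proof (cases "z $ i = sv w $ i")
      case True
      then show ?thesis using w by auto
    next
      case False
      obtain w' where "w' \<in> vertices P" "w' \<in> F" "sv w' = vec_update (sv w) i (z $ i)"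
        using bounded_face_neighbour[OF F(1,3) w(1,2) _ False] z by (auto simp: mem_coord_product)
      then show ?thesis using w insert.hyps by (intro exI[of _ w']) (auto simp: vec_update_nth)
    qed
  qed
  from this[of UNIV] show ?thesis using that by (auto simp: vec_eq_iff)
qed

text \<open>The optimality criterion of the simplex algorithm.\<close>

lemma local_max_imp_global_max:
  assumes F: "F face_of P" and v: "v \<in> vertices P" "v \<in> F"
    and nb: "\<And>i u. (i, u) \<in> neighbours (sv v) (bx F) \<Longrightarrow>
      \<exists>w\<in>vertices P. sv w = vec_update (sv v) i u \<and> \<phi> \<bullet> w \<le> \<phi> \<bullet> v"
    and x: "x \<in> F"
  shows "\<phi> \<bullet> x \<le> \<phi> \<bullet> v"
proof -
  obtain a e where fr: "\<And>j. j \<in> N v \<Longrightarrow> v \<in> Fc j \<and> bx (Fc j) = del j"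
    "\<And>j x. j \<in> N v \<Longrightarrow> x \<in> P \<Longrightarrow> a j \<bullet> (x - v) \<le> (0::real)"
    "\<And>j x. j \<in> N v \<Longrightarrow> x \<in> P \<Longrightarrow> x \<in> Fc j \<longleftrightarrow> a j \<bullet> (x - v) = 0"
    "\<And>j k. j \<in> N v \<Longrightarrow> k \<in> N v \<Longrightarrow> a k \<bullet> e j = (if k = j then - 1 else 0)"
    "\<And>x. x \<in> P \<Longrightarrow> x - v = (\<Sum>j\<in>N v. - (a j \<bullet> (x - v)) *\<^sub>R e j)"
    by (rule vertex_frame[OF v(1)]) (rule that; assumption)
  have F0: "F \<noteq> {}" using v by auto
  have xP: "x \<in> P" using x F face_of_imp_subset by blast
  have term_le: "- (a j \<bullet> (x - v)) * (\<phi> \<bullet> e j) \<le> 0" if j: "j \<in> N v" for j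
  proof -
    obtain i u where iu: "j = (i, u)" by (cases j)
    then have u: "u \<in> U i" "u \<noteq> sv v $ i" using j by (auto simp: mem_neighbours)
    show ?thesis
    proof (cases "u \<in> bx F i")
      case False
      then have "F \<subseteq> Fc j" using mem_bx_iff[OF F F0 u(1)] iu by blast
      then have "a j \<bullet> (x - v) = 0" using fr(3)[OF j xP] x by blast
      then show ?thesis by simp
    next
      case True
      then obtain w where w: "w \<in> vertices P" "sv w = vec_update (sv v) i u" "\<phi> \<bullet> w \<le> \<phi> \<bullet> v"
        using nb[of i u] u by (auto simp: mem_neighbours)
      have wP: "w \<in> P" using w(1) by (simp add: vertices_def extreme_point_of_def)
      \<comment> \<open>\<open>sv w\<close> differs from \<open>sv v\<close> only by
        \<open>u\<close> in coordinate \<open>i\<close>, so \<open>w\<close> lies on every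
        \<open>Fc k\<close> with \<open>k \<noteq> j\<close>, and \<open>w - v\<close> is a multiple
        of \<open>e j\<close>.\<close>
      have zero: "a k \<bullet> (w - v) = 0" if k: "k \<in> N v" "k \<noteq> j" for k
      proof -
        have Fk: "v \<in> Fc k" "bx (Fc k) = del k" using fr(1)[OF k(1)] by auto
        have "sv w $ l \<in> del k l" for l
        proof -
          have "sv w $ l \<in> U l" using sv(3)[OF w(1)] by (simp add: mem_coord_product)
          moreover have "(l, sv w $ l) \<noteq> k"
          proof
            assume eq: "(l, sv w $ l) = k"
            then have "sv w $ l \<noteq> sv v $ l" using k(1) by (auto simp: mem_neighbours)
            then have "l = i \<and> sv w $ l = u" using w(2) by (auto simp: vec_update_nth split: if_splits)
            then show False using eq iu k(2) by auto
          qed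
          ultimately show ?thesis by (simp add: mem_del)
        qed
        then have "w \<in> Fc k"
          using vertex_mem_face[OF w(1) Fc_face[of k]] Fk by (auto simp: mem_coord_product)
        then show ?thesis using fr(3)[OF k(1) wP] by blast
      qed
      let ?c = "- (a j \<bullet> (w - v))"
      have "w - v = (\<Sum>k\<in>N v. - (a k \<bullet> (w - v)) *\<^sub>R e k)" by (rule fr(5)[OF wP])
      also have "\<dots> = (\<Sum>k\<in>N v. if k = j then - (a k \<bullet> (w - v)) *\<^sub>R e k else 0)"
        using zero by (intro sum.cong refl) auto
      also have "\<dots> = ?c *\<^sub>R e j" using j finite_N by simp
      finally have wv: "w - v = ?c *\<^sub>R e j" .
      have "w \<noteq> v" using w(2) u(2) by (metis vec_update_nth)
      then have "?c \<noteq> 0" using wv by auto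
      then have c: "?c > 0" using fr(2)[OF j wP] by linarith
      have "?c * (\<phi> \<bullet> e j) = \<phi> \<bullet> (w - v)" by (subst wv) simp
      also have "\<dots> \<le> 0" using w(3) by (simp add: inner_diff_right)
      finally have "\<phi> \<bullet> e j \<le> 0" using c by (simp add: zero_le_mult_iff)
      then show ?thesis using fr(2)[OF j xP] by (simp add: mult_nonpos_nonpos)
    qed
  qed
  have "\<phi> \<bullet> (x - v) = (\<Sum>j\<in>N v. - (a j \<bullet> (x - v)) * (\<phi> \<bullet> e j))"
    by (subst fr(5)[OF xP]) (simp add: inner_sum_right)
  also have "\<dots> \<le> 0" using term_le by (intro sum_nonpos)
  finally show ?thesis by (simp add: inner_diff_right)
qed

text \<open>A face that contains \<open>x\<close> and \<open>x + r\<close> contains the whole ray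
  from \<open>x\<close> along \<open>r\<close>, on which \<open>\<phi>\<close> grows without
  bound.\<close>

lemma max_imp_bounded_face:
  assumes F: "F face_of P" and \<phi>: "\<And>r. r \<in> recession_directions P \<Longrightarrow> \<phi> \<bullet> r > 0"
    and max: "\<And>x. x \<in> F \<Longrightarrow> \<phi> \<bullet> x \<le> m"
  shows "bounded_face P F"
proof (rule ccontr)
  assume "\<not> ?thesis"
  then obtain r x where r: "r \<in> recession_directions P" and x: "x \<in> F" "x + r \<in> F"
    unfolding bounded_face_def by blast
  have xP: "x \<in> P" using x F face_of_imp_subset by blast
  have "\<phi> \<bullet> (x + t *\<^sub>R r) \<le> m" if t: "t \<ge> 0" for t
  proof -
    \<comment> \<open>The shift by 1 puts \<open>x + r\<close> strictly inside the segment for every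
      \<open>t > 0\<close>.\<close>
    have "x + (t + 1) *\<^sub>R r \<in> F"
    proof (cases "t = 0")
      case False
      have y: "x + (t + 1) *\<^sub>R r \<in> P" using r xP t by (simp add: recession_directions_def)
      have "x + r = (1 - 1 / (t + 1)) *\<^sub>R x + (1 / (t + 1)) *\<^sub>R (x + (t + 1) *\<^sub>R r)"
        using t by (simp add: scaleR_right_distrib algebra_simps flip: scaleR_left_distrib)
      moreover have "x \<noteq> x + (t + 1) *\<^sub>R r" using r t by (auto simp: recession_directions_def)
      moreover have "0 < 1 / (t + 1)" "1 / (t + 1) < 1" using t False by auto
      ultimately have "x + r \<in> open_segment x (x + (t + 1) *\<^sub>R r)" unfolding in_segment by blast
      then show ?thesis using face_ofD[OF F _ xP y x(2)] by blast
    qed (use x in simp)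
    then have "\<phi> \<bullet> (x + (t + 1) *\<^sub>R r) \<le> m" by (rule max)
    then show ?thesis using \<phi>[OF r] by (simp add: inner_add_right algebra_simps)
  qed
  then have "\<phi> \<bullet> r \<le> 0" by (rule ray_slope_nonpos)
  then show False using \<phi>[OF r] by linarith
qed

text \<open>A box through \<open>sv v\<close> in the sublevel set only uses coordinates of
  \<open>sv v\<close> and of its neighbours in that set, so it lies in the product of the sides
  \<open>C i\<close>. This product lies in the set itself: it is the box of a face on which
  \<open>v\<close> is maximal, hence of a bounded face.\<close>

lemma corner_of_sublevel:
  assumes \<phi>: "\<And>r. r \<in> recession_directions P \<Longrightarrow> \<phi> \<bullet> r > 0" and v: "v \<in> vertices P"
  shows "corner U (sv ` {w \<in> vertices P. \<phi> \<bullet> w \<le> \<phi> \<bullet> v}) (sv v)"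
proof -
  let ?S = "sv ` {w \<in> vertices P. \<phi> \<bullet> w \<le> \<phi> \<bullet> v}"
  define C where "C i = {u \<in> U i. vec_update (sv v) i u \<in> ?S}" for i
  have "vec_update (sv v) i (sv v $ i) = sv v" for i by (auto simp: vec_eq_iff vec_update_nth)
  then have sC: "sv v \<in> coord_product C"
    using v sv(3)[OF v] by (auto simp: C_def mem_coord_product)
  then have boxC: "box C" by (auto simp: C_def box_def mem_coord_product)
  obtain F where F: "F face_of P" "v \<in> F" "bx F = C" using ex_face_with_box[OF v boxC sC] by blast
  have max: "\<phi> \<bullet> x \<le> \<phi> \<bullet> v" if "x \<in> F" for x
    using that by (intro local_max_imp_global_max[OF F(1) v F(2)])
      (auto simp: F(3) mem_neighbours C_def)
  have bd: "bounded_face P F" using max_imp_bounded_face[OF F(1) \<phi> max] by blast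
  have F0: "F \<noteq> {}" using F by auto
  have CS: "coord_product C \<subseteq> ?S"
  proof
    fix z assume "z \<in> coord_product C"
    then obtain w where "w \<in> vertices P" "w \<in> F" "sv w = z"
      using bounded_face_full[OF F(1) F0 bd] F(3) by metis
    then show "z \<in> ?S" using max by blast
  qed
  have all: "B \<subseteq> coord_product C" if B: "is_box U B" "B \<subseteq> ?S" "sv v \<in> B" for B
  proof -
    obtain A where A: "\<forall>i. A i \<noteq> {} \<and> A i \<subseteq> U i" "B = coord_product A"
      using B(1) by (auto simp: is_box_def)
    have "A i \<subseteq> C i" for i
    proof
      fix u assume u: "u \<in> A i"
      then have "vec_update (sv v) i u \<in> coord_product A"
        using B(3) A(2) by (auto simp: mem_coord_product vec_update_nth)
      then show "u \<in> C i" using u A B(2) unfolding C_def by blast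
    qed
    then show ?thesis unfolding A(2) coord_product_def by blast
  qed
  have box: "is_box U (coord_product C)" using boxC unfolding is_box_def box_def by blast
  have max_box: "maximal_box_in U ?S (coord_product C)"
    unfolding maximal_box_in_def using box CS all sC by blast
  show ?thesis
    unfolding corner_def
  proof (intro conjI ex1I[of _ "coord_product C"])
    show "sv v \<in> ?S" using v by blast
    show "maximal_box_in U ?S (coord_product C)" by (rule max_box)
    show "sv v \<in> coord_product C" by (rule sC)
    fix B assume B: "maximal_box_in U ?S B \<and> sv v \<in> B"
    then have "B \<subseteq> coord_product C" using all unfolding maximal_box_in_def by blast
    then show "B = coord_product C" using B box CS unfolding maximal_box_in_def by blast
  qed
qed

end

section \<open>Ordering a finite set by a key, and the corner peeling\<close>

lemma enumerate_by_key:
  fixes key :: "'x \<Rightarrow> 'k::linorder"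
  assumes "finite S" "inj_on key S"
  obtains xs where "distinct xs" "set xs = S"
    "\<And>i. i < length xs \<Longrightarrow> set (take (Suc i) xs) = {y \<in> S. key y \<le> key (xs ! i)}"
proof -
  define xs where "xs = map (the_inv_into S key) (sorted_list_of_set (key ` S))"
  let ?ks = "sorted_list_of_set (key ` S)"
  have fin: "finite (key ` S)" using assms by simp
  have keys: "map key xs = ?ks"
    unfolding xs_def map_map using fin f_the_inv_into_f[OF assms(2)] by (intro map_idI) auto
  have set: "set xs = S" unfolding xs_def using fin the_inv_into_onto[OF assms(2)] by simp
  have dist: "distinct xs" using keys by (metis distinct_map distinct_sorted_list_of_set)
  have less: "key (xs ! a) < key (xs ! b)" if "a < b" "b < length xs" for a b
  proof -
    have len: "length xs = length ?ks" by (simp add: xs_def)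
    have "?ks ! a < ?ks ! b"
      using strict_sorted_list_of_set[of "key ` S"] that len by (simp add: sorted_wrt_iff_nth_less)
    then show ?thesis using that keys by (metis less_trans nth_map)
  qed
  show ?thesis
  proof (rule that[OF dist set])
    fix i assume i: "i < length xs"
    show "set (take (Suc i) xs) = {y \<in> S. key y \<le> key (xs ! i)}"
    proof
      show "set (take (Suc i) xs) \<subseteq> {y \<in> S. key y \<le> key (xs ! i)}"
      proof
        fix y assume y: "y \<in> set (take (Suc i) xs)"
        then obtain a where a: "a < Suc i" "y = xs ! a" using i by (auto simp: in_set_conv_nth)
        then have "key y \<le> key (xs ! i)" using less[of a i] i by (cases "a = i") (auto simp: less_imp_le)
        then show "y \<in> {y \<in> S. key y \<le> key (xs ! i)}" using y set in_set_takeD by fastforce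
      qed
      show "{y \<in> S. key y \<le> key (xs ! i)} \<subseteq> set (take (Suc i) xs)"
      proof
        fix y assume y: "y \<in> {y \<in> S. key y \<le> key (xs ! i)}"
        then obtain a where a: "a < length xs" "y = xs ! a" using set by (auto simp: in_set_conv_nth)
        then have "a \<le> i" using less[of i a] y by (metis (mono_tags, lifting) leD leI mem_Collect_eq)
        then show "y \<in> set (take (Suc i) xs)"
          using a i by (auto simp: in_set_conv_nth intro!: exI[of _ a])
      qed
    qed
  qed
qed

context prism_like
begin

lemma corner_peeling_b_set:
  "\<exists>xs. corner_peeling U (b_set P (coord_product \<Delta>) f) xs"
proof -
  obtain \<phi> where \<phi>: "\<And>r. r \<in> recession_directions P \<Longrightarrow> \<phi> \<bullet> r > 0"
    "inj_on (\<lambda>x. \<phi> \<bullet> x) (vertices P)"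
    using generic_functional[OF polyhedron pointed] by blast
  have "finite (vertices P)" using finite_polyhedron_extreme_points[OF polyhedron] by (simp add: vertices_def)
  from enumerate_by_key[OF this \<phi>(2)] obtain vs where vs: "distinct vs" "set vs = vertices P"
    "\<And>i. i < length vs \<Longrightarrow> set (take (Suc i) vs) = {w \<in> vertices P. \<phi> \<bullet> w \<le> \<phi> \<bullet> (vs ! i)}"
    by blast
  have inj: "inj_on sv (set vs)" using sv_inj vs(2) by (intro inj_onI) auto
  have "corner_peeling U (b_set P (coord_product \<Delta>) f) (map sv vs)"
    unfolding corner_peeling_def
  proof (intro conjI allI impI)
    show "distinct (map sv vs)" using vs(1) inj by (simp add: distinct_map)
    show "set (map sv vs) = b_set P (coord_product \<Delta>) f" by (simp add: b_set_eq vs(2))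
    fix i assume "i < length (map sv vs)"
    then have i: "i < length vs" by simp
    then have "vs ! i \<in> vertices P" using vs(2) nth_mem by blast
    then have "corner U (sv ` {w \<in> vertices P. \<phi> \<bullet> w \<le> \<phi> \<bullet> (vs ! i)}) (sv (vs ! i))"
      using corner_of_sublevel[of \<phi> "vs ! i"] \<phi>(1) by blast
    moreover have "set (take (Suc i) (map sv vs)) = sv ` {w \<in> vertices P. \<phi> \<bullet> w \<le> \<phi> \<bullet> (vs ! i)}"
      using vs(3)[OF i] by (simp add: take_map)
    ultimately show "corner U (set (take (Suc i) (map sv vs))) (map sv vs ! i)" using i by simp
  qed
  then show ?thesis by blast
qed

end

section \<open>Ampleness\<close>

text \<open>The distance to a set that may be empty; \<open>infdist x {} = 0\<close> would give the wrong zero set.\<close>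

definition gap :: "'a::metric_space set \<Rightarrow> 'a \<Rightarrow> real" where
  "gap T x = (if T = {} then 1 else infdist x T)"

lemma gap_nonneg: "gap T x \<ge> 0"
  by (simp add: gap_def infdist_nonneg)

lemma gap_eq_0_iff: "closed T \<Longrightarrow> gap T x = 0 \<longleftrightarrow> x \<in> T"
  by (auto simp: gap_def in_closed_iff_infdist_zero)

lemma continuous_on_gap: "continuous_on S g \<Longrightarrow> continuous_on S (\<lambda>x. gap T (g x))"
  by (cases "T = {}") (simp_all add: gap_def continuous_on_infdist)

text \<open>Points of weight zero are left unconstrained; this is what allows an average to be
  placed in a face.\<close>

lemma convex_normalized_sum:
  fixes y :: "'i \<Rightarrow> 'a::real_vector"
  assumes "convex C" "finite I" "\<And>i. i \<in> I \<Longrightarrow> m i \<ge> 0" "sum m I > (0::real)"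
    "\<And>i. i \<in> I \<Longrightarrow> m i \<noteq> 0 \<Longrightarrow> y i \<in> C"
  shows "(\<Sum>i\<in>I. (m i / sum m I) *\<^sub>R y i) \<in> C"
proof -
  let ?J = "{i\<in>I. m i \<noteq> 0}"
  have sum: "sum m ?J = sum m I" using assms(2) by (intro sum.mono_neutral_left) auto
  have "(\<Sum>i\<in>I. (m i / sum m I) *\<^sub>R y i) = (\<Sum>i\<in>?J. (m i / sum m I) *\<^sub>R y i)"
    using assms(2) by (intro sum.mono_neutral_right) auto
  also have "\<dots> \<in> C"
  proof (rule convex_sum[OF _ assms(1)])
    show "(\<Sum>i\<in>?J. m i / sum m I) = 1"
      using sum assms(4) by (simp add: sum_divide_distrib[symmetric])
  qed (use assms in \<open>auto simp: divide_nonneg_pos\<close>)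
  finally show ?thesis .
qed

context prism
begin

text \<open>A Knaster--Kuratowski--Mazurkiewicz lemma for products of simplices. It follows from Brouwer's
  theorem, applied to the map that moves \<open>t $ i\<close> towards a vertex in each block \<open>A\<close> at which
  \<open>q i A t\<close> is below its average over the blocks.\<close>

lemma product_kkm:
  fixes q :: "'m \<Rightarrow> 'b set \<Rightarrow> 'b ^ 'm \<Rightarrow> real"
  assumes \<alpha>: "generalized_partition U \<alpha>"
    and cont: "\<And>i A. A \<in> \<alpha> i \<Longrightarrow> continuous_on (coord_product \<Delta>) (q i A)"
    and nonneg: "\<And>i A t. A \<in> \<alpha> i \<Longrightarrow> t \<in> coord_product \<Delta> \<Longrightarrow> q i A t \<ge> 0"
    and pos: "\<And>i t. t \<in> coord_product \<Delta> \<Longrightarrow> (\<Sum>A\<in>\<alpha> i. q i A t) > 0"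
    and face: "\<And>i A t. A \<in> \<alpha> i \<Longrightarrow> t \<in> coord_product \<Delta> \<Longrightarrow> t $ i \<in> convex hull (U i - A) \<Longrightarrow> q i A t = 0"
  obtains t where "t \<in> coord_product \<Delta>" "\<And>i A. A \<in> \<alpha> i \<Longrightarrow> q i A t > 0"
proof -
  have part: "partition_on (U i) (\<alpha> i)" for i using \<alpha> by (simp add: generalized_partition_def)
  have fin: "finite (\<alpha> i)" for i using finite_elements[OF U(1) part] .
  have ne: "\<alpha> i \<noteq> {}" for i using part[of i] U(2)[of i] by (auto simp: partition_on_def)
  have Ane: "A \<noteq> {}" "A \<subseteq> U i" if "A \<in> \<alpha> i" for A i
    using part[of i] that by (auto simp: partition_on_def)
  define c where "c A = (SOME a. a \<in> A)" for A :: "'b set"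
  have c: "c A \<in> A" if "A \<in> \<alpha> i" for A i using Ane(1)[OF that] by (simp add: c_def some_in_eq)
  define avg where "avg i t = (\<Sum>A\<in>\<alpha> i. q i A t) / card (\<alpha> i)" for i t
  define deficit where "deficit i A t = max 0 (avg i t - q i A t)" for i A t
  define s where "s i t = (\<Sum>A\<in>\<alpha> i. deficit i A t)" for i t
  \<comment> \<open>The factor \<open>1 / (1 + s i t)\<close> makes the new coordinate a convex
    combination of \<open>t $ i\<close> and the vertices \<open>c A\<close>.\<close>
  define T where "T t = (\<chi> i. (1 / (1 + s i t)) *\<^sub>R (t $ i + (\<Sum>A\<in>\<alpha> i. deficit i A t *\<^sub>R c A)))" for t
  have deficit0: "deficit i A t \<ge> 0" for i A t by (simp add: deficit_def)
  have s0: "s i t \<ge> 0" for i t unfolding s_def using deficit0 by (intro sum_nonneg) auto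
  have deficit_cont: "continuous_on (coord_product \<Delta>) (deficit i A)" if "A \<in> \<alpha> i" for i A
    unfolding deficit_def avg_def using cont that ne fin
    by (intro continuous_intros) (auto simp: card_gt_0_iff)
  have "continuous_on (coord_product \<Delta>) (s i)" for i
    unfolding s_def using deficit_cont by (intro continuous_on_sum) auto
  moreover have "1 + s i t \<noteq> 0" for i t using s0[of i t] by linarith
  ultimately have contT: "continuous_on (coord_product \<Delta>) T"
    unfolding T_def using deficit_cont by (intro continuous_intros continuous_on_component) auto
  have "T \<in> coord_product \<Delta> \<rightarrow> coord_product \<Delta>"
  proof
    fix t assume t: "t \<in> coord_product \<Delta>"
    have "T t $ i \<in> \<Delta> i" for i
    proof -
      have conv: "convex (\<Delta> i)" using U(4)[of i] by (metis convex_convex_hull)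
      have cD: "c A \<in> \<Delta> i" if "A \<in> \<alpha> i" for A
        using c[OF that] Ane(2)[OF that] U(4)[of i] hull_subset[of "U i" convex] by blast
      have tD: "t $ i \<in> \<Delta> i" using t by (simp add: mem_coord_product)
      show ?thesis
      proof (cases "s i t = 0")
        case True
        then have "deficit i A t = 0" if "A \<in> \<alpha> i" for A
          using that deficit0 fin unfolding s_def by (simp add: sum_nonneg_eq_0_iff)
        then show ?thesis using True tD by (simp add: T_def)
      next
        case False
        then have sp: "s i t > 0" using s0[of i t] by linarith
        let ?z = "\<Sum>A\<in>\<alpha> i. (deficit i A t / s i t) *\<^sub>R c A"
        have "?z \<in> \<Delta> i"
          unfolding s_def using conv fin deficit0 cD sp
          by (intro convex_normalized_sum) (auto simp: s_def)
        then have "(1 / (1 + s i t)) *\<^sub>R t $ i + (s i t / (1 + s i t)) *\<^sub>R ?z \<in> \<Delta> i"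
          using conv tD sp by (intro convexD) (auto simp: divide_simps)
        moreover have "(\<Sum>A\<in>\<alpha> i. deficit i A t *\<^sub>R c A) = s i t *\<^sub>R ?z"
          using sp by (simp add: scaleR_sum_right)
        ultimately show ?thesis by (simp add: T_def scaleR_add_right)
      qed
    qed
    then show "T t \<in> coord_product \<Delta>" by (simp add: mem_coord_product)
  qed
  then obtain t where t: "t \<in> coord_product \<Delta>" "T t = t"
    using brouwer[OF compact_prism convex_prism _ contT] box_face_nonempty[OF box_U]
    unfolding box_face_U by blast
  have "q i A t > 0" if A: "A \<in> \<alpha> i" for i A
  proof -
    have cardpos: "card (\<alpha> i) > 0" using fin ne by (simp add: card_gt_0_iff)
    have avg_pos: "avg i t > 0" unfolding avg_def using pos[OF t(1)] cardpos by simp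
    have avg_sum: "(\<Sum>A\<in>\<alpha> i. avg i t - q i A t) = 0"
      using cardpos by (simp add: sum_subtractf avg_def)
    have fixed: "s i t *\<^sub>R t $ i = (\<Sum>A\<in>\<alpha> i. deficit i A t *\<^sub>R c A)"
    proof -
      have "(1 + s i t) *\<^sub>R t $ i = (1 + s i t) *\<^sub>R T t $ i" using t(2) by simp
      also have "\<dots> = t $ i + (\<Sum>A\<in>\<alpha> i. deficit i A t *\<^sub>R c A)"
        using s0[of i t] by (simp add: T_def)
      finally show ?thesis by (simp add: scaleR_left_distrib)
    qed
    \<comment> \<open>Otherwise some block \<open>B\<close> is above average and has no deficit, so
      \<open>t $ i\<close> is a combination of vertices outside \<open>B\<close>, and the boundary
      condition forces \<open>q i B t = 0\<close>.\<close>
    have "s i t = 0"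
    proof (rule ccontr)
      assume "s i t \<noteq> 0"
      then have sp: "s i t > 0" using s0[of i t] by linarith
      have "\<exists>B\<in>\<alpha> i. avg i t - q i B t < 0"
      proof (rule ccontr)
        assume "\<not> ?thesis"
        then have "\<forall>B\<in>\<alpha> i. avg i t - q i B t = 0"
          using avg_sum fin by (subst sum_nonneg_eq_0_iff[symmetric]) (auto simp: not_less)
        then have "s i t = 0" unfolding s_def deficit_def by simp
        then show False using sp by simp
      qed
      then obtain B where B: "B \<in> \<alpha> i" "avg i t < q i B t" by auto
      have "(\<Sum>A\<in>\<alpha> i. (deficit i A t / s i t) *\<^sub>R c A) \<in> convex hull (U i - B)"
        unfolding s_def
      proof (rule convex_normalized_sum)
        show "(\<Sum>A\<in>\<alpha> i. deficit i A t) > 0" using sp by (simp add: s_def)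
        fix A assume A: "A \<in> \<alpha> i" "deficit i A t \<noteq> 0"
        then have "A \<noteq> B" using B(2) by (auto simp: deficit_def)
        then have "A \<inter> B = {}" using part[of i] A B by (auto simp: partition_on_def disjoint_def)
        then have "c A \<in> U i - B" using c[OF A(1)] Ane(2)[OF A(1)] by blast
        then show "c A \<in> convex hull (U i - B)" by (rule hull_inc)
      qed (use fin deficit0 in auto)
      moreover have "t $ i = (\<Sum>A\<in>\<alpha> i. (deficit i A t / s i t) *\<^sub>R c A)"
      proof -
        have "t $ i = (1 / s i t) *\<^sub>R (s i t *\<^sub>R t $ i)" using sp by simp
        then show ?thesis unfolding fixed by (simp add: scaleR_sum_right)
      qed
      ultimately have "q i B t = 0" using face[OF B(1) t(1)] by simp
      then show False using B(2) avg_pos by simp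
    qed
    then have "deficit i A t = 0" using A deficit0 fin unfolding s_def by (simp add: sum_nonneg_eq_0_iff)
    then have "avg i t \<le> q i A t" by (simp add: deficit_def max_def split: if_splits)
    then show ?thesis using avg_pos by linarith
  qed
  then show ?thesis using that t(1) by blast
qed

end

context prism_like
begin

section \<open>From shattering to strong shattering\<close>

lemma closed_Fc: "closed (Fc j)"
  using face_of_polyhedron_polyhedron[OF polyhedron Fc_face] polyhedron_imp_closed by blast

text \<open>A face that meets the relative interior of \<open>F\<close> contains
  \<open>F\<close>.\<close>

lemma mem_Fc_iff_minimal_face:
  assumes F: "F face_of P" "y \<in> rel_interior F" and u: "u \<in> U i"
  shows "y \<in> Fc (i, u) \<longleftrightarrow> u \<notin> bx F i"
proof -
  have yF: "y \<in> F" using F(2) rel_interior_subset by blast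
  then have "y \<in> Fc (i, u) \<longleftrightarrow> F \<subseteq> Fc (i, u)"
    using subset_of_face_of[OF Fc_face, of F "(i, u)"] F face_of_imp_subset by blast
  then show ?thesis using mem_bx_iff[OF F(1) _ u] yF by blast
qed

lemma vertex_mem_Fc:
  assumes v: "v \<in> vertices P" and u: "u \<in> U i" "u \<noteq> sv v $ i"
  shows "v \<in> Fc (i, u)"
proof -
  have "{v} face_of P" using v by (simp add: vertex_face)
  then show ?thesis using mem_bx_iff[of "{v}" u i] sv(2)[OF v] u by auto
qed

lemma shattered_imp_strongly_shattered:
  assumes \<alpha>: "generalized_partition U \<alpha>" and sh: "shattered \<alpha> (sv ` vertices P)"
  shows "strongly_shattered \<alpha> (sv ` vertices P)"
proof -
  have part: "partition_on (U i) (\<alpha> i)" for i using \<alpha> by (simp add: generalized_partition_def)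
  have fin: "finite (\<alpha> i)" for i using finite_elements[OF U(1) part] .
  have Asub: "A \<subseteq> U i" if "A \<in> \<alpha> i" for A i using part[of i] that by (auto simp: partition_on_def)
  have finA: "finite A" if "A \<in> \<alpha> i" for A i using Asub[OF that] U(1) finite_subset by blast
  let ?I = "PiE UNIV \<alpha>"
  have finI: "finite ?I" using fin by (intro finite_PiE) auto
  have "\<exists>v. v \<in> vertices P \<and> (\<forall>i. sv v $ i \<in> p i)" if p: "p \<in> ?I" for p
  proof -
    have "(\<chi> i. p i) \<in> minor_subproduct \<alpha>"
      using p by (auto simp: minor_subproduct_def mem_coord_product)
    then have "coord_product (($) (\<chi> i. p i)) \<in> box_partition \<alpha>"
      unfolding box_partition_def by blast
    then obtain v where "v \<in> vertices P" "sv v \<in> coord_product (($) (\<chi> i. p i))"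
      using sh unfolding shattered_def by blast
    then show ?thesis by (auto simp: mem_coord_product)
  qed
  then obtain x where x: "\<And>p. p \<in> ?I \<Longrightarrow> x p \<in> vertices P \<and> (\<forall>i. sv (x p) $ i \<in> p i)" by metis
  obtain \<rho> where \<rho>: "continuous_on P \<rho>" "\<rho> \<in> P \<rightarrow> P" "\<And>F x. F face_of P \<Longrightarrow> x \<in> F \<Longrightarrow> \<rho> x \<in> F"
    "\<And>x F. x \<in> P \<Longrightarrow> F face_of P \<Longrightarrow> \<rho> x \<in> rel_interior F \<Longrightarrow> bounded_face P F"
    by (rule push_to_bounded_faces[OF polyhedron pointed]) (rule that)
  \<comment> \<open>Vanishes exactly when \<open>t $ i\<close> lies in the face of the simplex
    opposite to the block \<open>A\<close>; \<open>gap\<close> covers \<open>A = U i\<close>, where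
    that face is empty.\<close>
  define \<gamma> where "\<gamma> i A t = gap (convex hull (U i - A)) (t $ i)" for i A and t :: "'b ^ 'm"
  have \<gamma>0: "\<gamma> i A t \<ge> 0" for i A t by (simp add: \<gamma>_def gap_nonneg)
  have cl: "closed (convex hull (U i - A))" for i A
    using U(1) by (intro compact_imp_closed finite_imp_compact_convex_hull) auto
  have \<gamma>_eq_0: "\<gamma> i A t = 0 \<longleftrightarrow> t $ i \<in> convex hull (U i - A)" for i A t
    unfolding \<gamma>_def by (rule gap_eq_0_iff[OF cl])
  \<comment> \<open>The faces opposite to the blocks have no common point: for affinely independent
    vertices the hulls intersect in the hull of the intersection, which is empty.\<close>
  have \<gamma>_pos: "\<exists>A\<in>\<alpha> i. \<gamma> i A t > 0" for i t
  proof (rule ccontr)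
    assume "\<not> ?thesis"
    then have all: "t $ i \<in> convex hull (U i - A)" if "A \<in> \<alpha> i" for A
      using that \<gamma>0 \<gamma>_eq_0 by (metis less_eq_real_def)
    have "(\<Inter>A\<in>\<alpha> i. U i - A) = {}"
      using part[of i] U(2)[of i] by (auto simp: partition_on_def)
    moreover have "convex hull (\<Inter>((\<lambda>A. U i - A) ` \<alpha> i)) = (\<Inter>T\<in>(\<lambda>A. U i - A) ` \<alpha> i. convex hull T)"
    proof (rule convex_hull_Inter)
      have "\<Union>((\<lambda>A. U i - A) ` \<alpha> i) \<subseteq> U i" by blast
      then show "\<not> affine_dependent (\<Union>((\<lambda>A. U i - A) ` \<alpha> i))"
        using U(3) affine_independent_subset by blast
    qed
    ultimately have "t $ i \<in> convex hull {}" using all by auto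
    then show False by simp
  qed
  \<comment> \<open>Product weights: on the face opposite to the block \<open>A\<close> in
    coordinate \<open>i\<close>, every \<open>x p\<close> with \<open>p i = A\<close> drops out, and
    the remaining vertices lie in \<open>Fc (i, u)\<close> for each \<open>u\<close> in
    \<open>A\<close>.\<close>
  define m where "m t p = (\<Prod>i\<in>UNIV. \<gamma> i (p i) t)" for t p
  define g where "g t = (\<Sum>p\<in>?I. (m t p / sum (m t) ?I) *\<^sub>R x p)" for t
  have m0: "m t p \<ge> 0" for t p unfolding m_def using \<gamma>0 by (intro prod_nonneg) auto
  have msum: "sum (m t) ?I > 0" for t
  proof -
    obtain p where p: "\<And>i. p i \<in> \<alpha> i \<and> \<gamma> i (p i) t > 0" using \<gamma>_pos[of _ t] by metis
    then have "p \<in> ?I" "m t p > 0" unfolding m_def by (auto intro!: prod_pos)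
    then show ?thesis using m0 finI by (intro sum_pos2[of _ p]) auto
  qed
  have \<gamma>_cont: "continuous_on S (\<gamma> i A)" for S i A
    unfolding \<gamma>_def by (intro continuous_on_gap continuous_intros)
  have m_cont: "continuous_on S (\<lambda>t. m t p)" for S p
    unfolding m_def by (intro continuous_on_prod \<gamma>_cont)
  have g_cont: "continuous_on S g" for S
    unfolding g_def using msum by (intro continuous_intros m_cont) (metis less_irrefl)
  have g_mem: "g t \<in> C" if "convex C" "\<And>p. p \<in> ?I \<Longrightarrow> m t p \<noteq> 0 \<Longrightarrow> x p \<in> C" for t C
    unfolding g_def using that m0 msum finI by (intro convex_normalized_sum) auto
  have xP: "x p \<in> P" if "p \<in> ?I" for p
    using x[OF that] by (auto simp: vertices_def extreme_point_of_def)
  have gP: "g t \<in> P" for t using xP convex_P by (intro g_mem) auto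
  define y where "y t = \<rho> (g t)" for t
  have yP: "y t \<in> P" for t using gP \<rho>(2) by (auto simp: y_def)
  have y_cont: "continuous_on S y" for S
    unfolding y_def using gP by (intro continuous_on_compose2[OF \<rho>(1) g_cont]) auto
  have gF: "g t \<in> Fc (i, u)" if A: "A \<in> \<alpha> i" "u \<in> A" and t: "t $ i \<in> convex hull (U i - A)" for i A u t
  proof (rule g_mem)
    show "convex (Fc (i, u))" using Fc_face face_of_imp_convex by blast
    fix p assume p: "p \<in> ?I" "m t p \<noteq> 0"
    then have "\<gamma> i (p i) t \<noteq> 0" by (auto simp: m_def)
    then have "p i \<noteq> A" using t \<gamma>_eq_0 by metis
    moreover have pi: "p i \<in> \<alpha> i" using p by auto
    ultimately have "p i \<inter> A = {}" using part[of i] A by (auto simp: partition_on_def disjoint_def)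
    then have "u \<noteq> sv (x p) $ i" using x[OF p(1)] A by blast
    then show "x p \<in> Fc (i, u)" using vertex_mem_Fc x[OF p(1)] A Asub[OF A(1)] by blast
  qed
  \<comment> \<open>For a block \<open>A\<close>, zero exactly when \<open>y t\<close> lies in all
    \<open>Fc (i, u)\<close> with \<open>u\<close> in \<open>A\<close>, that is, when the box of the
    minimal face of \<open>y t\<close> misses \<open>A\<close> in coordinate
    \<open>i\<close>.\<close>
  define q where "q i A t = (\<Sum>u\<in>A. gap (Fc (i, u)) (y t))" for i A t
  obtain t where t: "t \<in> coord_product \<Delta>" "\<And>i A. A \<in> \<alpha> i \<Longrightarrow> q i A t > 0"
  proof (rule product_kkm[OF \<alpha>])
    show "continuous_on (coord_product \<Delta>) (q i A)" for i A
      unfolding q_def by (intro continuous_on_sum continuous_on_gap y_cont)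
    show "q i A t \<ge> 0" for i A t unfolding q_def by (intro sum_nonneg gap_nonneg)
    show "q i A t = 0" if "A \<in> \<alpha> i" "t $ i \<in> convex hull (U i - A)" for i A t
    proof -
      have "y t \<in> Fc (i, u)" if "u \<in> A" for u
        unfolding y_def by (rule \<rho>(3)[OF Fc_face gF[OF \<open>A \<in> \<alpha> i\<close> that \<open>t $ i \<in> _\<close>]])
      then have "gap (Fc (i, u)) (y t) = 0" if "u \<in> A" for u
        using gap_eq_0_iff[OF closed_Fc] that by blast
      then show ?thesis unfolding q_def by simp
    qed
    show "(\<Sum>A\<in>\<alpha> i. q i A t) > 0" for i t
    proof -
      obtain F where F: "F face_of P" "y t \<in> rel_interior F"
        using polyhedron_minimal_face[OF polyhedron yP] by blast
      then have "F \<noteq> {}" by auto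
      then obtain u where u: "u \<in> bx F i" "u \<in> U i"
        using box_bx(1)[OF F(1)] unfolding box_def by blast
      then have "gap (Fc (i, u)) (y t) > 0"
        using mem_Fc_iff_minimal_face[OF F u(2)] gap_eq_0_iff[OF closed_Fc, of "(i, u)" "y t"] gap_nonneg
        by (metis less_eq_real_def)
      moreover obtain A where A: "A \<in> \<alpha> i" "u \<in> A" using part[of i] u(2) by (auto simp: partition_on_def)
      ultimately have "q i A t > 0"
        unfolding q_def by (intro sum_pos2[OF finA[OF A(1)] A(2)] gap_nonneg)
      then show ?thesis
        using A(1) fin by (intro sum_pos2[of _ A]) (auto simp: q_def intro!: sum_nonneg gap_nonneg)
    qed
  qed (rule that)
  obtain F where F: "F face_of P" "y t \<in> rel_interior F"
    using polyhedron_minimal_face[OF polyhedron yP] by blast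
  have F0: "F \<noteq> {}" using F(2) by auto
  have bd: "bounded_face P F" using \<rho>(4)[OF gP F(1)] F(2) by (simp add: y_def)
  have "\<exists>u. u \<in> A \<and> u \<in> bx F i" if A: "A \<in> \<alpha> i" for i A
  proof -
    have "(\<Sum>u\<in>A. gap (Fc (i, u)) (y t)) \<noteq> 0" using t(2)[OF A] by (simp add: q_def)
    then obtain u where u: "u \<in> A" "gap (Fc (i, u)) (y t) \<noteq> 0" by (rule sum.not_neutral_contains_not_neutral)
    then have "y t \<notin> Fc (i, u)" using gap_eq_0_iff[OF closed_Fc] by blast
    then show ?thesis using mem_Fc_iff_minimal_face[OF F] u(1) Asub[OF A] by blast
  qed
  then have "\<forall>i A. \<exists>u. A \<in> \<alpha> i \<longrightarrow> u \<in> A \<and> u \<in> bx F i" by blast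
  then obtain w where w: "\<And>i A. A \<in> \<alpha> i \<Longrightarrow> w i A \<in> A \<and> w i A \<in> bx F i" by metis
  \<comment> \<open>The copy is chosen inside the box of \<open>F\<close>; disjointness of the
    blocks leaves exactly one element of \<open>W i\<close> in each.\<close>
  define W where "W i = w i ` \<alpha> i" for i
  have "W i \<subseteq> bx F i" for i using w by (auto simp: W_def)
  then have "coord_product W \<subseteq> coord_product (bx F)" unfolding coord_product_def by blast
  also have "\<dots> \<subseteq> sv ` vertices P" using bounded_face_full[OF F(1) F0 bd] by blast
  finally have "coord_product W \<subseteq> sv ` vertices P" .
  moreover have "is_copy \<alpha> (coord_product W)"
    unfolding is_copy_def
  proof (intro exI[of _ W] conjI allI ballI)
    show "W i \<subseteq> \<Union>(\<alpha> i)" for i using w by (auto simp: W_def)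
    fix i A assume A: "A \<in> \<alpha> i"
    have "z = w i A" if "z \<in> W i \<inter> A" for z
    proof -
      obtain A' where A': "A' \<in> \<alpha> i" "z = w i A'" using \<open>z \<in> W i \<inter> A\<close> by (auto simp: W_def)
      then have "z \<in> A' \<inter> A" using w \<open>z \<in> W i \<inter> A\<close> by auto
      then have "A' = A" using part[of i] A A'(1) by (auto simp: partition_on_def disjoint_def)
      then show ?thesis using A' by simp
    qed
    moreover have "w i A \<in> W i \<inter> A" using w[OF A] A by (auto simp: W_def)
    ultimately show "\<exists>!z. z \<in> W i \<inter> A" by blast
  qed simp
  ultimately show ?thesis unfolding strongly_shattered_def by blast
qed

lemma ample_b_set: "ample U (b_set P (coord_product \<Delta>) f)"
  unfolding ample_def b_set_eq using sv(3) shattered_imp_strongly_shattered by blast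

end

section \<open>Polyhedra without vertices, and the theorem\<close>

context prism
begin

text \<open>Every box partition has at least one box, and the empty set meets none, so nothing is
  shattered.\<close>

lemma ample_empty: "ample U {}"
proof -
  have "\<not> shattered \<alpha> {}" if \<alpha>: "generalized_partition U \<alpha>" for \<alpha>
  proof -
    have "\<alpha> i \<noteq> {}" for i
      using \<alpha> U(2)[of i] by (auto simp: generalized_partition_def partition_on_def)
    then have "minor_subproduct \<alpha> \<noteq> {}" unfolding minor_subproduct_def by (rule coord_product_nonempty)
    then show ?thesis by (auto simp: shattered_def box_partition_def)
  qed
  then show ?thesis by (auto simp: ample_def)
qed

end

theorem theorem17:
  fixes P :: "'a::euclidean_space set"
    and \<Delta> :: "'m::finite \<Rightarrow> 'b::euclidean_space set"
    and f :: "'a set \<Rightarrow> ('b ^ 'm) set"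
    and d :: nat
  assumes "polyhedron P" and "aff_dim P = int d"
    and "prism_factors \<Delta>" and "aff_dim (coord_product \<Delta>) = int d"
    and "face_lattice_injection P (coord_product \<Delta>) f"
  shows "ample (\<lambda>i. vertices (\<Delta> i)) (b_set P (coord_product \<Delta>) f) \<and>
         (\<exists>xs. corner_peeling (\<lambda>i. vertices (\<Delta> i)) (b_set P (coord_product \<Delta>) f) xs)"
proof -
  interpret prism \<Delta> using assms by unfold_locales
  have U_eq: "(\<lambda>i. vertices (\<Delta> i)) = U" by (simp add: U_def fun_eq_iff)
  show ?thesis
  proof (cases "vertices P = {}")
    case True
    then have empty: "b_set P (coord_product \<Delta>) f = {}" by (simp add: b_set_def)
    have "corner_peeling U {} []" by (simp add: corner_peeling_def)
    then show ?thesis unfolding empty U_eq using ample_empty by blast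
  next
    case False
    then obtain v\<^sub>0 where "v\<^sub>0 extreme_point_of P" by (auto simp: vertices_def)
    then interpret prism_like \<Delta> P f d v\<^sub>0 using assms by unfold_locales
    show ?thesis unfolding U_eq using ample_b_set corner_peeling_b_set by blast
  qed
qed

end
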